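(* For every integer $n\ge 2$, $$\tau(n)\le \left(1+\eta_3\frac{\log n}{\omega(n)\log_+ \omega(n)}\right)^{\omega(n)},$$ where $$\eta_3:=\lambda(720\,p_1\cdots p_7)=\frac{(1152^{1/7}-1)\,7\log 7}{\log 367567200}=1.1999953\dots$$
   Context: $\tau(n)$ denotes the number of positive divisors of $n$, $\omega(n)$ the number of distinct prime factors of $n$, $\log_+ x:=\log\max(2,x)$, and $p_i$ denotes the $i$-th prime. For an integer $n$ with $k=\omega(n)\ge 2$, $\lambda(n):=\dfrac{(\tau(n)^{1/k}-1)k\log k}{\log n}$. *)

theory Defs
  imports
    "HOL-Analysis.Analysis"
    "HOL-Library.Infinite_Set"
    "HOL-Computational_Algebra.Primes"
begin

definition tau :: "nat \<Rightarrow> nat" where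
  "tau n = card {d. d dvd n}"

definition omega :: "nat \<Rightarrow> nat" where
  "omega n = card (prime_factors n)"

definition log_plus :: "real \<Rightarrow> real" where
  "log_plus x = ln (max 2 x)"

text \<open>The primes are indexed from \<open>1\<close>, i.e. \<open>nth_prime 1 = 2\<close>, while \<^const>\<open>enumerate\<close>
  counts from \<open>0\<close>. The value at \<open>0\<close> is junk.\<close>

definition nth_prime :: "nat \<Rightarrow> nat" where
  "nth_prime i = enumerate {p. prime p} (i - 1)"

text \<open>Only meaningful for \<open>omega n \<ge> 2\<close>.\<close>

definition lambda :: "nat \<Rightarrow> real" where
  "lambda n =
     (real (tau n) powr (1 / real (omega n)) - 1) * real (omega n) * ln (real (omega n))
       / ln (real n)"

definition eta3 :: real where
  "eta3 = lambda (720 * (\<Prod>i=1..7. nth_prime i))"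

end

theory Submission
  imports Defs
begin

text \<open>
  Write \<open>k = omega n\<close>, let \<open>P\<^sub>1 < \<dots> < P\<^sub>k\<close> be the prime factors of \<open>n\<close> with exponents
  \<open>a\<^sub>i \<ge> 1\<close>, so that \<open>tau n = \<Prod>(1 + a\<^sub>i)\<close> and \<open>P\<^sub>i\<close> is at least the \<open>i\<close>-th prime \<open>p\<^sub>i\<close>.
  Two upper bounds are compared with \<open>(1 + c ln n)\<^sup>k\<close>.

  Relaxation. For weights \<open>0 < w\<^sub>i \<le> ln p\<^sub>i\<close> the inequality between the arithmetic and the geometric mean,
  applied to the numbers \<open>w\<^sub>i (1 + a\<^sub>i)\<close>, yields
  \<open>tau n * \<Prod>w\<^sub>i \<le> ((ln n + \<Sum>w\<^sub>i) / k)\<^sup>k\<close>. This is affine in \<open>ln n\<close> after taking \<open>k\<close>-th roots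
  and suffices for \<open>k \<le> 4\<close>, for \<open>k \<ge> 14\<close>, and for large \<open>n\<close> otherwise. For \<open>k \<ge> 20\<close>
  the crude bound \<open>p\<^sub>i \<ge> 3 i\<close> is enough.

  Tangents. For \<open>5 \<le> k \<le> 13\<close> the integrality of the exponents matters. If
  \<open>ln ((b + 2) / (b + 1)) \<le> t ln p \<le> ln ((b + 1) / b)\<close>, then
  \<open>ln (1 + a) \<le> ln (1 + b) + (a - b) t ln p\<close> for all integers \<open>a \<ge> 1\<close> (if \<open>b = 1\<close>, the upper
  restriction on \<open>t ln p\<close> can be dropped); hence \<open>ln (tau n)\<close> lies below a line in \<open>ln n\<close>.
  As \<open>k ln (1 + c L)\<close> is concave in \<open>L\<close>, the comparison on an interval reduces to its
  end points. The constant is attained for \<open>k = 7\<close> at \<open>n = 2\<^sup>5 3\<^sup>3 5\<^sup>2 7 11 13 17 = 367567200\<close>,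
  which therefore has to be an end point.
\<close>

subsection \<open>Divisors and prime factors\<close>

lemma tau_mult_coprime:
  assumes "coprime a b" "a > 0" "b > 0"
  shows "tau (a * b) = tau a * tau b"
proof -
  have inj: "inj_on (\<lambda>(x, y). x * y) ({d. d dvd a} \<times> {d. d dvd b})"
  proof (rule inj_onI, clarify)
    fix x y x' y' assume *: "x dvd a" "y dvd b" "x' dvd a" "y' dvd b" "x * y = x' * y'"
    have "coprime x y'" "coprime x' y"
      using assms(1) * by (meson coprime_divisors)+
    moreover have "x dvd x' * y'" "x' dvd x * y" using * by (metis dvd_triv_left)+
    ultimately have "x = x'"
      by (meson coprime_dvd_mult_left_iff dvd_antisym)
    moreover have "x > 0" using * assms by (auto intro: Nat.gr0I)
    ultimately show "x = x' \<and> y = y'" using *(5) by simp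
  qed
  have "{d. d dvd a * b} = (\<lambda>(x, y). x * y) ` ({d. d dvd a} \<times> {d. d dvd b})"
    by (auto simp: image_iff intro: mult_dvd_mono dest!: division_decomp)
  then show ?thesis
    by (simp add: tau_def card_image[OF inj] card_cartesian_product)
qed

lemma tau_prime_power:
  assumes "prime p"
  shows "tau (p ^ e) = Suc e"
proof -
  have "{d. d dvd p ^ e} = (\<lambda>i. p ^ i) ` {..e}"
    using assms by (auto simp: divides_primepow_nat le_imp_power_dvd)
  moreover have "inj_on (\<lambda>i. p ^ i) {..e}"
    using assms by (auto simp: inj_on_def dest: prime_power_inj)
  ultimately show ?thesis by (simp add: tau_def card_image)
qed

lemma tau_prod_prime_powers:
  assumes "finite S" "\<And>p. p \<in> S \<Longrightarrow> prime p"
  shows "tau (\<Prod>p\<in>S. p ^ e p) = (\<Prod>p\<in>S. Suc (e p))"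
  using assms
proof (induction S rule: finite_induct)
  case empty
  have "{d::nat. d dvd 1} = {1}" by auto
  then show ?case by (simp add: tau_def)
next
  case (insert q S)
  have "coprime (q ^ e q) (\<Prod>p\<in>S. p ^ e p)"
    using insert by (intro prod_coprime_right) (auto intro!: primes_coprime)
  moreover have "(\<Prod>p\<in>S. p ^ e p) > 0"
    using insert by (intro prod_pos) (auto simp: prime_gt_0_nat)
  ultimately show ?case
    using insert by (simp add: tau_mult_coprime tau_prime_power prime_gt_0_nat)
qed

lemma tau_eq_prod_multiplicity:
  assumes "n > 0"
  shows "tau n = (\<Prod>p\<in>prime_factors n. Suc (multiplicity p n))"
  using tau_prod_prime_powers[of "prime_factors n" "\<lambda>p. multiplicity p n"]
    prime_factorization_nat[OF assms] by (simp add: in_prime_factors_imp_prime)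

lemma ln_eq_sum_multiplicity:
  assumes "n > 0"
  shows "ln (real n) = (\<Sum>p\<in>prime_factors n. real (multiplicity p n) * ln (real p))"
proof -
  have "ln (real n) = ln (\<Prod>p\<in>prime_factors n. real p ^ multiplicity p n)"
    by (subst prime_factorization_nat[OF assms]) simp
  also have "\<dots> = (\<Sum>p\<in>prime_factors n. ln (real p ^ multiplicity p n))"
    by (rule ln_prod) (auto simp: prime_gt_0_nat in_prime_factors_imp_prime)
  finally show ?thesis by (simp add: ln_realpow)
qed

section \<open>Values and growth of the \<open>i\<close>-th prime\<close>

lemma prime_nth_prime: "prime (nth_prime i)"
  using enumerate_in_set[OF primes_infinite] by (simp add: nth_prime_def)

lemma nth_prime_1: "nth_prime 1 = 2"
  unfolding nth_prime_def by (auto simp: enumerate_0 intro!: Least_equality prime_ge_2_nat)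

lemma nth_prime_Suc:
  assumes "i \<ge> 1"
  shows "nth_prime (Suc i) = (LEAST p. prime p \<and> nth_prime i < p)"
  using enumerate_Suc''[OF primes_infinite, of "i - 1"] assms
  by (simp add: nth_prime_def)

text \<open>Recasts the least-element description as a check of the finite gap, so that the first
  primes can be evaluated one after another.\<close>

lemma nth_prime_SucI:
  assumes "nth_prime i = p" "i \<ge> 1" "prime q" "p < q" "\<forall>r\<in>{p<..<q}. \<not> prime r"
  shows "nth_prime (Suc i) = q"
  unfolding nth_prime_Suc[OF assms(2)] using assms
  by (intro Least_equality) (auto simp: not_less[symmetric])

lemma nth_prime_less_Suc:
  assumes "i \<ge> 1"
  shows "nth_prime i < nth_prime (Suc i)"
  using LeastI_ex[of "\<lambda>p. prime p \<and> nth_prime i < p"] bigger_prime[of "nth_prime i"]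
  by (auto simp: nth_prime_Suc[OF assms])

text \<open>By induction the next element of \<open>S\<close> is a prime above
  \<open>nth_prime (Suc i)\<close>, so the least such prime cannot exceed it. The index is shifted
  because \<open>enumerate\<close> counts from 0.\<close>

lemma nth_prime_le_enumerate:
  assumes "finite S" "\<And>p. p \<in> S \<Longrightarrow> prime p" "i < card S"
  shows "nth_prime (Suc i) \<le> enumerate S i"
  using assms(3)
proof (induction i)
  case 0
  then have "prime (enumerate S 0)" using finite_enumerate_in_set[OF assms(1)] assms(2) by blast
  then show ?case using nth_prime_1 prime_ge_2_nat by simp
next
  case (Suc i)
  have "prime (enumerate S (Suc i))"
    using finite_enumerate_in_set[OF assms(1) Suc.prems] assms(2) by blast
  moreover have "nth_prime (Suc i) < enumerate S (Suc i)"
    using finite_enumerate_step[OF assms(1) Suc.prems] Suc by linarith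
  ultimately show ?case by (subst nth_prime_Suc) (auto intro: Least_le)
qed

text \<open>Listing the prime factors in increasing order makes each comparable with the prime of
  the same rank. Both upper bounds start from these four facts.\<close>

lemma sorted_factorization:
  assumes "n \<ge> 2"
  obtains P a :: "nat \<Rightarrow> nat" where
    "real (tau n) = (\<Prod>i<omega n. 1 + real (a i))"
    "ln (real n) = (\<Sum>i<omega n. real (a i) * ln (real (P i)))"
    "\<And>i. i < omega n \<Longrightarrow> 1 \<le> a i"
    "\<And>i. i < omega n \<Longrightarrow> nth_prime (Suc i) \<le> P i"
proof
  let ?S = "prime_factors n"
  have bij: "bij_betw (enumerate ?S) {..<omega n} ?S"
    unfolding omega_def by (rule finite_bij_enumerate) simp
  have "real (tau n) = (\<Prod>p\<in>?S. 1 + real (multiplicity p n))"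
    using assms by (simp add: tau_eq_prod_multiplicity)
  then show "real (tau n) = (\<Prod>i<omega n. 1 + real (multiplicity (enumerate ?S i) n))"
    by (simp add: prod.reindex_bij_betw[OF bij, symmetric])
  have "ln (real n) = (\<Sum>p\<in>?S. real (multiplicity p n) * ln (real p))"
    using assms by (intro ln_eq_sum_multiplicity) auto
  then show "ln (real n) = (\<Sum>i<omega n. real (multiplicity (enumerate ?S i) n)
      * ln (real (enumerate ?S i)))"
    by (simp add: sum.reindex_bij_betw[OF bij, symmetric])
  show "1 \<le> multiplicity (enumerate ?S i) n" if "i < omega n" for i
  proof -
    have "enumerate ?S i \<in> ?S" using bij that by (auto simp: bij_betw_def)
    then have "multiplicity (enumerate ?S i) n > 0"
      by (simp add: prime_factors_multiplicity)
    then show ?thesis by simp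
  qed
  show "nth_prime (Suc i) \<le> enumerate ?S i" if "i < omega n" for i
    using that by (intro nth_prime_le_enumerate) (auto simp: omega_def)
qed

text \<open>From 5 on all primes are odd, so each gap is at least 2. A double gap below 6 would then
  force \<open>m\<close>, \<open>m + 2\<close>, \<open>m + 4\<close>, and 3 divides one of
  these.\<close>

lemma nth_prime_add_6_le:
  assumes "i \<ge> 3"
  shows "nth_prime i + 6 \<le> nth_prime (Suc (Suc i))"
proof -
  have not_dvd: "\<not> 2 dvd nth_prime j" "\<not> 3 dvd nth_prime j" if "j \<ge> 3" for j
  proof -
    have "nth_prime j > 3"
      using that
    proof (induction j rule: dec_induct)
      case base
      show ?case using nth_prime_1 nth_prime_less_Suc[of 1] nth_prime_less_Suc[of 2]
        by (simp add: numeral_eq_Suc)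
    next
      case (step j)
      then show ?case using nth_prime_less_Suc[of j] by simp
    qed
    then show "\<not> 2 dvd nth_prime j" "\<not> 3 dvd nth_prime j"
      using prime_nth_prime[of j] primes_dvd_imp_eq[of 2 "nth_prime j"]
        primes_dvd_imp_eq[of 3 "nth_prime j"] by auto
  qed
  have step: "nth_prime j + 2 \<le> nth_prime (Suc j)" if "j \<ge> 3" for j
  proof -
    have "nth_prime (Suc j) \<noteq> nth_prime j + 1"
      using not_dvd(1)[of j] not_dvd(1)[of "Suc j"] that by auto
    then show ?thesis using nth_prime_less_Suc[of j] that by linarith
  qed
  show ?thesis
  proof (rule ccontr)
    assume "\<not> ?thesis"
    moreover have "nth_prime (Suc (Suc i)) \<noteq> nth_prime i + 5"
      using not_dvd(1)[of i] not_dvd(1)[of "Suc (Suc i)"] assms by auto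
    ultimately have "nth_prime (Suc i) = nth_prime i + 2" "nth_prime (Suc (Suc i)) = nth_prime i + 4"
      using step[of i] step[of "Suc i"] assms by linarith+
    moreover have "3 dvd m \<or> 3 dvd m + 2 \<or> 3 dvd m + 4" for m :: nat by presburger
    ultimately show False
      using not_dvd(2)[of i] not_dvd(2)[of "Suc i"] not_dvd(2)[of "Suc (Suc i)"] assms
      by (metis le_Suc_eq)
  qed
qed

definition small_primes :: "nat list" where
  "small_primes = [2, 3, 5, 7, 11, 13, 17, 19, 23, 29, 31, 37, 41, 43, 47, 53, 59, 61, 67, 71]"

lemma nth_prime_values: "map nth_prime [1..<21] = small_primes"
proof -
  \<comment> \<open>As the set of a list, the gap can be tested number by number by the
    simplifier.\<close>
  have gap: "{p<..<q} = set [Suc p..<q]" for p q :: nat by auto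
  note step = nth_prime_SucI[unfolded gap]
  have 1: "nth_prime 1 = 2" by (rule nth_prime_1)
  have 2: "nth_prime 2 = 3" using step[OF 1, of 3, unfolded Suc_1] by simp
  have 3: "nth_prime 3 = 5" using step[OF 2, of 5] by simp
  have 4: "nth_prime 4 = 7" using step[OF 3, of 7] by simp
  have 5: "nth_prime 5 = 11" using step[OF 4, of 11] by simp
  have 6: "nth_prime 6 = 13" using step[OF 5, of 13] by simp
  have 7: "nth_prime 7 = 17" using step[OF 6, of 17] by simp
  have 8: "nth_prime 8 = 19" using step[OF 7, of 19] by simp
  have 9: "nth_prime 9 = 23" using step[OF 8, of 23] by simp
  have 10: "nth_prime 10 = 29" using step[OF 9, of 29] by simp
  have 11: "nth_prime 11 = 31" using step[OF 10, of 31] by simp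
  have 12: "nth_prime 12 = 37" using step[OF 11, of 37] by simp
  have 13: "nth_prime 13 = 41" using step[OF 12, of 41] by simp
  have 14: "nth_prime 14 = 43" using step[OF 13, of 43] by simp
  have 15: "nth_prime 15 = 47" using step[OF 14, of 47] by simp
  have 16: "nth_prime 16 = 53" using step[OF 15, of 53] by simp
  have 17: "nth_prime 17 = 59" using step[OF 16, of 59] by simp
  have 18: "nth_prime 18 = 61" using step[OF 17, of 61] by simp
  have 19: "nth_prime 19 = 67" using step[OF 18, of 67] by simp
  have 20: "nth_prime 20 = 71" using step[OF 19, of 71] by simp
  have "[1..<21] = (1::nat) # [2..<21]"
    by (rule upt_conv_Cons[of 1 21, unfolded Suc_1]) simp
  then show ?thesis
    using 1 2 3 4 5 6 7 8 9 10 11 12 13 14 15 16 17 18 19 20 by (simp add: small_primes_def)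
qed

lemma nth_prime_eq_small_primes:
  assumes "i < 20"
  shows "nth_prime (Suc i) = small_primes ! i"
  using arg_cong[OF nth_prime_values, of "\<lambda>xs. xs ! i"] assms by (simp add: small_primes_def)

text \<open>Induction in steps of two: the prime grows by at least 6, \<open>3 * i\<close> by
  exactly 6. The two starting cases compare 71 with 60 and 73 with 63.\<close>

lemma nth_prime_ge_3_mult:
  assumes "i \<ge> 20"
  shows "3 * i \<le> nth_prime i"
  using assms
proof (induction i rule: less_induct)
  case (less i)
  have "nth_prime 20 = 71" using arg_cong[OF nth_prime_values, of "\<lambda>xs. xs ! 19"]
    by (simp add: small_primes_def)
  then have "nth_prime (Suc 20) > 71" using nth_prime_less_Suc[of 20] by simp
  moreover have "\<not> prime (72::nat)" by simp
  then have "nth_prime (Suc 20) \<noteq> 72" using prime_nth_prime by metis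
  ultimately have "nth_prime (Suc 20) \<ge> 73" by simp
  show ?case
  proof (cases "i \<ge> 22")
    case True
    define j where "j = i - 2"
    have "i = Suc (Suc j)" "j \<ge> 20" using True by (auto simp: j_def)
    then show ?thesis using less.IH[of j] nth_prime_add_6_le[of j] by simp
  next
    case False
    then have "i = 20 \<or> i = Suc 20" using less.prems by auto
    then show ?thesis
    proof
      assume "i = Suc 20"
      with \<open>nth_prime (Suc 20) \<ge> 73\<close> show ?thesis by simp
    qed (use \<open>nth_prime 20 = 71\<close> in simp)
  qed
qed

subsection \<open>The two upper bounds for the number of divisors\<close>

text \<open>Weights below the logarithms of the primes leave room for rational ones.
  \<open>sum_le_ln\<close> rests on all exponents being at least 1; it supplies the smallest
  \<open>ln n\<close> to be considered.\<close>

lemma tau_le_relaxed: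
  fixes w :: "nat \<Rightarrow> real"
  assumes n: "n \<ge> 2" and k: "omega n = k" "k \<ge> 1"
    and w: "\<And>i. i < k \<Longrightarrow> 0 < w i" "\<And>i. i < k \<Longrightarrow> w i \<le> ln (real (nth_prime (Suc i)))"
  shows sum_le_ln: "(\<Sum>i<k. w i) \<le> ln (real n)"
    and tau_mult_prod_le: "real (tau n) * (\<Prod>i<k. w i) \<le> ((ln (real n) + (\<Sum>i<k. w i)) / real k) ^ k"
proof -
  obtain a P :: "nat \<Rightarrow> nat" where Pa: "real (tau n) = (\<Prod>i<k. 1 + real (a i))"
    "ln (real n) = (\<Sum>i<k. real (a i) * ln (real (P i)))"
    "\<And>i. i < k \<Longrightarrow> 1 \<le> a i" "\<And>i. i < k \<Longrightarrow> nth_prime (Suc i) \<le> P i"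
    by (rule sorted_factorization[OF n, unfolded k(1)]) blast
  have wP: "w i \<le> ln (real (P i))" if "i < k" for i
  proof -
    have "0 < nth_prime (Suc i)" by (simp add: prime_nth_prime prime_gt_0_nat)
    then have "ln (real (nth_prime (Suc i))) \<le> ln (real (P i))" using Pa(4)[OF that] by simp
    then show ?thesis using w(2)[OF that] by simp
  qed
  have le: "(\<Sum>i<k. real (a i) * w i) \<le> ln (real n)"
    unfolding Pa(2) using wP by (intro sum_mono mult_left_mono) auto
  have "(\<Sum>i<k. w i) \<le> (\<Sum>i<k. real (a i) * w i)"
    using Pa(3) w(1) by (intro sum_mono) (simp add: less_imp_le)
  with le show "(\<Sum>i<k. w i) \<le> ln (real n)" by simp
  let ?x = "\<lambda>i. (1 + real (a i)) * w i"
  have pos: "?x i > 0" if "i < k" for i using w(1)[OF that] by (simp add: add_pos_nonneg)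
  have prod_pos: "(\<Prod>i<k. ?x i) > 0" using pos by (intro prod_pos) auto
  have "(\<Prod>i<k. ?x i) powr (1 / real k) \<le> (\<Sum>i<k. ?x i / real k)"
    using arith_geom_mean[of "{..<k}" ?x] k(2) pos by (auto simp: lessThan_empty_iff less_imp_le)
  then have "((\<Prod>i<k. ?x i) powr (1 / real k)) ^ k \<le> (\<Sum>i<k. ?x i / real k) ^ k"
    by (intro power_mono) auto
  also have "((\<Prod>i<k. ?x i) powr (1 / real k)) ^ k = (\<Prod>i<k. ?x i)"
  proof -
    have "(x powr (1 / real k)) ^ k = x" if "x > 0" for x :: real
      using that k(2) by (subst powr_power) auto
    from this[OF prod_pos] show ?thesis .
  qed
  finally have "real (tau n) * (\<Prod>i<k. w i) \<le> (\<Sum>i<k. ?x i / real k) ^ k"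
    by (simp add: Pa(1) prod.distrib)
  also have "(\<Sum>i<k. ?x i / real k) = ((\<Sum>i<k. real (a i) * w i) + (\<Sum>i<k. w i)) / real k"
    by (simp add: sum_divide_distrib[symmetric] sum.distrib[symmetric] algebra_simps)
  also have "\<dots> ^ k \<le> ((ln (real n) + (\<Sum>i<k. w i)) / real k) ^ k"
    using le w(1) by (intro power_mono divide_right_mono divide_nonneg_nonneg add_nonneg_nonneg
      sum_nonneg) (auto simp: less_imp_le)
  finally show "real (tau n) * (\<Prod>i<k. w i) \<le> ((ln (real n) + (\<Sum>i<k. w i)) / real k) ^ k" .
qed

text \<open>With the geometric mean of the weights replaced by its lower bound \<open>g\<close>, the
  \<open>k\<close>-th root of the relaxed bound is affine in \<open>ln n\<close> with slope
  \<open>1 / (k * g)\<close>. As this slope is at most \<open>c\<close>, the inequality at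
  \<open>A\<close> persists to the right of \<open>A\<close>.\<close>

lemma tau_le_if_relaxed_le:
  fixes w :: "nat \<Rightarrow> real"
  assumes n: "n \<ge> 2" and k: "omega n = k" "k \<ge> 1"
    and w: "\<And>i. i < k \<Longrightarrow> 0 < w i" "\<And>i. i < k \<Longrightarrow> w i \<le> ln (real (nth_prime (Suc i)))"
    and g: "0 < g" "g ^ k \<le> (\<Prod>i<k. w i)"
    and c: "1 / (real k * g) \<le> c"
    and A: "A \<le> ln (real n)" "(A + (\<Sum>i<k. w i)) / (real k * g) \<le> 1 + c * A"
  shows "real (tau n) \<le> (1 + c * ln (real n)) ^ k"
proof -
  let ?X = "\<Sum>i<k. w i" and ?L = "ln (real n)"
  have gk: "0 < g ^ k" using g by simp
  have X: "0 \<le> ?X" using w(1) by (intro sum_nonneg) (auto simp: less_imp_le)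
  have "real (tau n) * g ^ k \<le> ((?L + ?X) / real k) ^ k"
    using tau_mult_prod_le[OF n k w] mult_left_mono[OF g(2), of "real (tau n)"] by simp
  then have "real (tau n) \<le> ((?L + ?X) / (real k * g)) ^ k"
    using gk by (simp add: pos_le_divide_eq[symmetric] power_divide power_mult_distrib mult.commute)
  also have "(?L + ?X) / (real k * g) = (A + ?X) / (real k * g) + 1 / (real k * g) * (?L - A)"
    by (simp add: add_divide_distrib diff_divide_distrib)
  also have "\<dots> ^ k \<le> (1 + c * ?L) ^ k"
  proof (rule power_mono)
    have "1 / (real k * g) * (?L - A) \<le> c * (?L - A)" using c A(1) by (intro mult_right_mono) auto
    then show "(A + ?X) / (real k * g) + 1 / (real k * g) * (?L - A) \<le> 1 + c * ?L"
      using A(2) by (simp add: algebra_simps)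
    have "0 \<le> (?L + ?X) / (real k * g)" using X g n by simp
    then show "0 \<le> (A + ?X) / (real k * g) + 1 / (real k * g) * (?L - A)"
      by (simp add: add_divide_distrib diff_divide_distrib)
  qed
  finally show ?thesis .
qed

section \<open>Discrete tangent lines\<close>

lemma ln_Suc_diff_antimono:
  assumes "0 < a" "a \<le> b"
  shows "ln (real b + 1) - ln (real b) \<le> ln (real a + 1) - ln (real a)"
proof -
  have "ln ((real b + 1) / real b) \<le> ln ((real a + 1) / real a)"
    using assms by (subst ln_le_cancel_iff) (auto simp: field_simps)
  then show ?thesis using assms by (simp add: ln_div)
qed

text \<open>The increments of \<open>ln\<close> decrease and \<open>s\<close> separates those above
  \<open>b\<close> from those below, so the inequality spreads from \<open>b\<close> one unit at a
  time. For \<open>b = 1\<close> only the upward direction occurs.\<close>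

lemma ln_Suc_le_tangent:
  assumes "1 \<le> a" "1 \<le> b"
    and s: "ln (real b + 2) - ln (real b + 1) \<le> s"
    and s': "b = 1 \<or> s \<le> ln (real b + 1) - ln (real b)"
  shows "ln (1 + real a) \<le> ln (1 + real b) + (real a - real b) * s"
proof (cases "b \<le> a")
  case True
  then show ?thesis
  proof (induction a rule: dec_induct)
    case (step a)
    have "ln (real a + 2) - ln (real a + 1) \<le> s"
      using ln_Suc_diff_antimono[of "b + 1" "a + 1"] step.hyps s by (simp add: add.commute)
    then show ?case using step.IH by (simp add: algebra_simps)
  qed simp
next
  case False
  then have "a \<le> b" "b \<noteq> 1" using assms(1) by auto
  from this(1) show ?thesis
    using assms(1)
  proof (induction a rule: inc_induct)
    case (step a)
    have "s \<le> ln (real a + 2) - ln (real a + 1)"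
      using ln_Suc_diff_antimono[of "a + 1" b] step.hyps s' \<open>b \<noteq> 1\<close> by (simp add: add.commute)
    then show ?case using step by (simp add: algebra_simps)
  qed simp
qed

text \<open>Sums the tangents at \<open>b i\<close> with slopes \<open>t * ln p\<close>, which are
  proportional to the cost in \<open>ln n\<close> of raising an exponent. The line is exact when
  \<open>n\<close> is the product of the first \<open>k\<close> primes with exponents
  \<open>b i\<close>.\<close>

lemma ln_tau_le_tangent:
  assumes n: "n \<ge> 2" and k: "omega n = k" and t: "0 \<le> t"
    and b: "\<And>i. i < k \<Longrightarrow> 1 \<le> b i"
    "\<And>i. i < k \<Longrightarrow> ln (real (b i) + 2) - ln (real (b i) + 1) \<le> t * ln (real (nth_prime (Suc i)))"
    "\<And>i. i < k \<Longrightarrow> b i = 1 \<or>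
       t * ln (real (nth_prime (Suc i))) \<le> ln (real (b i) + 1) - ln (real (b i))"
  shows "ln (real (tau n)) \<le>
    (\<Sum>i<k. ln (real (b i) + 1) - t * (real (b i) * ln (real (nth_prime (Suc i))))) + t * ln (real n)"
proof -
  obtain a P :: "nat \<Rightarrow> nat" where Pa: "real (tau n) = (\<Prod>i<k. 1 + real (a i))"
    "ln (real n) = (\<Sum>i<k. real (a i) * ln (real (P i)))"
    "\<And>i. i < k \<Longrightarrow> 1 \<le> a i" "\<And>i. i < k \<Longrightarrow> nth_prime (Suc i) \<le> P i"
    by (rule sorted_factorization[OF n, unfolded k(1)]) blast
  let ?p = "\<lambda>i. ln (real (nth_prime (Suc i)))"
  have "ln (real (tau n)) = (\<Sum>i<k. ln (1 + real (a i)))"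
    unfolding Pa(1) by (rule ln_prod) auto
  also have "\<dots> \<le> (\<Sum>i<k. ln (1 + real (b i)) + (real (a i) - real (b i)) * (t * ?p i))"
    using b Pa(3) by (intro sum_mono ln_Suc_le_tangent) auto
  also have "\<dots> = (\<Sum>i<k. ln (real (b i) + 1) - t * (real (b i) * ?p i)) + t * (\<Sum>i<k. real (a i) * ?p i)"
    by (simp add: sum_distrib_left sum.distrib[symmetric] algebra_simps)
  also have "(\<Sum>i<k. real (a i) * ?p i) \<le> ln (real n)"
    unfolding Pa(2)
  proof (intro sum_mono mult_left_mono)
    fix i assume "i \<in> {..<k}"
    moreover have "0 < nth_prime (Suc i)" by (simp add: prime_nth_prime prime_gt_0_nat)
    ultimately show "?p i \<le> ln (real (P i))" using Pa(4)[of i] by simp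
  qed simp
  finally show ?thesis using t by (simp add: mult_left_mono)
qed

lemma concave_ln_affine_ge:
  fixes c :: real
  assumes "0 \<le> c" "0 \<le> A" "A \<le> L" "L \<le> B"
    and "C + t * A \<le> k * ln (1 + c * A)" "C + t * B \<le> k * ln (1 + c * B)" "0 \<le> k"
  shows "C + t * L \<le> k * ln (1 + c * L)"
proof (cases "A = B")
  case False
  define u where "u = (L - A) / (B - A)"
  have AB: "A < B" using False assms by simp
  have u: "0 \<le> u" "u \<le> 1" using AB assms by (auto simp: u_def)
  have uBA: "u * (B - A) = L - A" using AB by (simp add: u_def)
  have L: "L = (1 - u) * A + u * B" using uBA by (simp add: algebra_simps)
  have "(1 - u) * ln (1 + c * A) + u * ln (1 + c * B) \<le> ln ((1 - u) *\<^sub>R (1 + c * A) + u *\<^sub>R (1 + c * B))"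
    using assms AB by (intro concave_onD[OF ln_concave] u) (auto intro: add_pos_nonneg)
  also have "(1 - u) *\<^sub>R (1 + c * A) + u *\<^sub>R (1 + c * B) = 1 + c * L"
    by (simp add: L algebra_simps)
  finally have "k * ((1 - u) * ln (1 + c * A) + u * ln (1 + c * B)) \<le> k * ln (1 + c * L)"
    using assms(7) by (rule mult_left_mono)
  moreover have "(1 - u) * (C + t * A) \<le> (1 - u) * (k * ln (1 + c * A))"
    "u * (C + t * B) \<le> u * (k * ln (1 + c * B))"
    using assms u by (auto intro: mult_left_mono)
  moreover have "(1 - u) * (C + t * A) + u * (C + t * B) = C + t * L"
    by (simp add: L algebra_simps)
  moreover have "k * ((1 - u) * ln (1 + c * A) + u * ln (1 + c * B))
      = (1 - u) * (k * ln (1 + c * A)) + u * (k * ln (1 + c * B))"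
    by (simp add: algebra_simps)
  ultimately show ?thesis by linarith
next
  case True
  then have "L = A" using assms by simp
  then show ?thesis using assms(5) by simp
qed

lemma tau_pos: "n > 0 \<Longrightarrow> tau n > 0"
  by (simp add: tau_eq_prod_multiplicity prod_pos)

lemma tau_le_if_tangent_le:
  assumes n: "n \<ge> 2" and k: "omega n = k" and t: "0 \<le> t"
    and b: "\<And>i. i < k \<Longrightarrow> 1 \<le> b i"
    "\<And>i. i < k \<Longrightarrow> ln (real (b i) + 2) - ln (real (b i) + 1) \<le> t * ln (real (nth_prime (Suc i)))"
    "\<And>i. i < k \<Longrightarrow> b i = 1 \<or>
       t * ln (real (nth_prime (Suc i))) \<le> ln (real (b i) + 1) - ln (real (b i))"
    and C: "C = (\<Sum>i<k. ln (real (b i) + 1) - t * (real (b i) * ln (real (nth_prime (Suc i)))))"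
    and c: "0 \<le> c" and AB: "0 \<le> A" "A \<le> ln (real n)" "ln (real n) \<le> B"
    "C + t * A \<le> real k * ln (1 + c * A)" "C + t * B \<le> real k * ln (1 + c * B)"
  shows "real (tau n) \<le> (1 + c * ln (real n)) ^ k"
proof -
  have "ln (real (tau n)) \<le> real k * ln (1 + c * ln (real n))"
    using ln_tau_le_tangent[OF n k t b] concave_ln_affine_ge[OF c AB]
    by (simp add: C)
  also have "\<dots> = ln ((1 + c * ln (real n)) ^ k)"
    using c AB by (simp add: ln_realpow add_pos_nonneg)
  finally show ?thesis
    using tau_pos[of n] n c AB by (simp add: add_pos_nonneg)
qed

subsection \<open>Logarithms of small primes\<close>

text \<open>The quotients are \<open>p / (p - 1)\<close>: close to 1, where the series behind
  \<open>ln_approx_bounds\<close> converges fast, and with \<open>p - 1\<close> composed of primes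
  treated before.\<close>

lemma ln_small_quotients:
  "ln (2::real) \<in> {0.6931471805..0.6931471806}"
  "ln (3 / 2::real) \<in> {0.4054651081..0.4054651082}"
  "ln (5 / 4::real) \<in> {0.2231435513..0.2231435514}"
  "ln (7 / 6::real) \<in> {0.1541506798..0.1541506799}"
  "ln (11 / 10::real) \<in> {0.0953101798..0.0953101799}"
  "ln (13 / 12::real) \<in> {0.0800427076..0.0800427077}"
  "ln (17 / 16::real) \<in> {0.0606246218..0.0606246219}"
  using ln_approx_bounds[of 2 11] ln_approx_bounds[of "3 / 2" 7] ln_approx_bounds[of "5 / 4" 5]
    ln_approx_bounds[of "7 / 6" 5] ln_approx_bounds[of "11 / 10" 4] ln_approx_bounds[of "13 / 12" 4]
    ln_approx_bounds[of "17 / 16" 3]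
  by (simp_all add: lessThan_nat_numeral lessThan_Suc power_divide)

lemma ln_composites:
  "ln (4::real) = 2 * ln 2" "ln (6::real) = ln 2 + ln 3" "ln (8::real) = 3 * ln 2"
  "ln (9::real) = 2 * ln 3" "ln (10::real) = ln 2 + ln 5" "ln (12::real) = 2 * ln 2 + ln 3"
  "ln (14::real) = ln 2 + ln 7" "ln (15::real) = ln 3 + ln 5" "ln (16::real) = 4 * ln 2"
  "ln (18::real) = ln 2 + 2 * ln 3" "ln (20::real) = 2 * ln 2 + ln 5"
  using ln_realpow[of "2::real" 2] ln_realpow[of "2::real" 3] ln_realpow[of "2::real" 4]
    ln_realpow[of "3::real" 2] ln_mult[of "2::real" 3] ln_mult[of "2::real" 5] ln_mult[of "4::real" 3]
    ln_mult[of "2::real" 7] ln_mult[of "3::real" 5] ln_mult[of "2::real" 9] ln_mult[of "4::real" 5]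
  by simp_all

lemma ln_prime_bounds:
  shows ln2: "0.6931471805 \<le> ln (2::real)" "ln (2::real) \<le> 0.6931471806"
  and ln3: "1.0986122886 \<le> ln (3::real)" "ln (3::real) \<le> 1.0986122888"
  and ln5: "1.6094379123 \<le> ln (5::real)" "ln (5::real) \<le> 1.6094379126"
  and ln7: "1.9459101489 \<le> ln (7::real)" "ln (7::real) \<le> 1.9459101493"
  and ln11: "2.3978952726 \<le> ln (11::real)" "ln (11::real) \<le> 2.3978952731"
  and ln13: "2.5649493572 \<le> ln (13::real)" "ln (13::real) \<le> 2.5649493577"
  and ln17: "2.8332133438 \<le> ln (17::real)" "ln (17::real) \<le> 2.8332133443"
  using ln_small_quotients by (simp_all add: ln_div ln_composites)

text \<open>The first term of the same series. It passes from \<open>p - 1\<close> to a larger prime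
  \<open>p\<close>, and also controls increments of \<open>ln\<close> in the induction for large
  \<open>k\<close>.\<close>

lemma ln_add_one_ge:
  fixes x :: real
  assumes "x > 0"
  shows "ln x + 2 / (2 * x + 1) \<le> ln (x + 1)"
proof -
  have "2 * (((x + 1) / x - 1) / ((x + 1) / x + 1)) \<le> ln ((x + 1) / x)"
    using ln_approx_bounds[of "(x + 1) / x" 1] assms by simp
  also have "((x + 1) / x - 1) / ((x + 1) / x + 1) = 1 / (2 * x + 1)"
    using assms by (simp add: divide_simps)
  finally show ?thesis using assms by (simp add: ln_div)
qed

text \<open>Rational weights for the first twenty primes, kept to at most four decimals so that
  products of them remain easy to evaluate.\<close>

definition ln_lower :: "real list" where
  "ln_lower = [0.6931, 1.0986, 1.6094, 1.9459, 2.3978, 2.5649, 2.8332, 2.9444, 3.1354, 3.3672, 3.4339,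
    3.6109, 3.7135, 3.7611, 3.85, 3.9702, 4.0774, 4.1108, 4.2046, 4.2626]"

text \<open>Each \<open>p - 1\<close> splits into smaller primes. The cases 47 and 59 rest on those
  of 23 and 29, since 46 = 2 * 23 and 58 = 2 * 29.\<close>

lemma ln_large_prime_lower:
  shows ln19: "2.9444 \<le> ln (19::real)"
    and ln23: "3.1354 \<le> ln (23::real)"
    and ln29: "3.3672 \<le> ln (29::real)"
    and ln31: "3.4339 \<le> ln (31::real)"
    and ln37: "3.6109 \<le> ln (37::real)"
    and ln41: "3.7135 \<le> ln (41::real)"
    and ln43: "3.7611 \<le> ln (43::real)"
    and ln47: "3.85 \<le> ln (47::real)"
    and ln53: "3.9702 \<le> ln (53::real)"
    and ln59: "4.0774 \<le> ln (59::real)"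
    and ln61: "4.1108 \<le> ln (61::real)"
    and ln67: "4.2046 \<le> ln (67::real)"
    and ln71: "4.2626 \<le> ln (71::real)"
proof -
  have "ln (22::real) = ln 2 + ln 11"
    "ln (28::real) = ln 4 + ln 7"
    "ln (30::real) = ln 2 + ln 15"
    "ln (36::real) = ln 4 + ln 9"
    "ln (40::real) = ln 4 + ln 10"
    "ln (42::real) = ln 6 + ln 7"
    "ln (46::real) = ln 2 + ln 23"
    "ln (52::real) = ln 4 + ln 13"
    "ln (58::real) = ln 2 + ln 29"
    "ln (60::real) = ln 6 + ln 10"
    "ln (66::real) = ln 6 + ln 11"
    "ln (70::real) = ln 7 + ln 10"
    using ln_mult[of "2::real" 11]
      ln_mult[of "4::real" 7]
      ln_mult[of "2::real" 15]
      ln_mult[of "4::real" 9]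
      ln_mult[of "4::real" 10]
      ln_mult[of "6::real" 7]
      ln_mult[of "2::real" 23]
      ln_mult[of "4::real" 13]
      ln_mult[of "2::real" 29]
      ln_mult[of "6::real" 10]
      ln_mult[of "6::real" 11]
      ln_mult[of "7::real" 10]
    by simp_all
  note * = this
  show 19: "2.9444 \<le> ln (19::real)"
    using ln_add_one_ge[of 18] ln_prime_bounds by (simp add: ln_composites)
  show 23: "3.1354 \<le> ln (23::real)"
    using ln_add_one_ge[of 22] ln_prime_bounds *(1) by (simp add: ln_composites)
  show 29: "3.3672 \<le> ln (29::real)"
    using ln_add_one_ge[of 28] ln_prime_bounds *(2) by (simp add: ln_composites)
  show 31: "3.4339 \<le> ln (31::real)"
    using ln_add_one_ge[of 30] ln_prime_bounds *(3) by (simp add: ln_composites)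
  show 37: "3.6109 \<le> ln (37::real)"
    using ln_add_one_ge[of 36] ln_prime_bounds *(4) by (simp add: ln_composites)
  show 41: "3.7135 \<le> ln (41::real)"
    using ln_add_one_ge[of 40] ln_prime_bounds *(5) by (simp add: ln_composites)
  show 43: "3.7611 \<le> ln (43::real)"
    using ln_add_one_ge[of 42] ln_prime_bounds *(6) by (simp add: ln_composites)
  show 47: "3.85 \<le> ln (47::real)"
    using ln_add_one_ge[of 46] ln_prime_bounds *(7) 23 by (simp add: ln_composites)
  show 53: "3.9702 \<le> ln (53::real)"
    using ln_add_one_ge[of 52] ln_prime_bounds *(8) by (simp add: ln_composites)
  show 59: "4.0774 \<le> ln (59::real)"
    using ln_add_one_ge[of 58] ln_prime_bounds *(9) 29 by (simp add: ln_composites)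
  show 61: "4.1108 \<le> ln (61::real)"
    using ln_add_one_ge[of 60] ln_prime_bounds *(10) by (simp add: ln_composites)
  show 67: "4.2046 \<le> ln (67::real)"
    using ln_add_one_ge[of 66] ln_prime_bounds *(11) by (simp add: ln_composites)
  show 71: "4.2626 \<le> ln (71::real)"
    using ln_add_one_ge[of 70] ln_prime_bounds *(12) by (simp add: ln_composites)
qed

lemma ln_lower_le: "list_all2 (\<lambda>w p. 0 < w \<and> w \<le> ln (real p)) ln_lower small_primes"
  unfolding ln_lower_def small_primes_def
  using ln_prime_bounds ln_large_prime_lower by simp

lemma ln_lower_nth:
  assumes "i < 20"
  shows "0 < ln_lower ! i" "ln_lower ! i \<le> ln (real (nth_prime (Suc i)))"
  using list_all2_nthD[OF ln_lower_le, of i] assms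
  by (auto simp: ln_lower_def nth_prime_eq_small_primes)

text \<open>Its instances serve as rewrite rules for the logarithm of one concrete fraction. The
  first seven arguments are the exponents of 2, 3, 5, 7, 11, 13, 17 in the numerator, the last seven
  those in the denominator.\<close>

lemma ln_smooth_quotient:
  "ln ((2 ^ a * 3 ^ b * 5 ^ c * 7 ^ d * 11 ^ e * 13 ^ f * 17 ^ g) /
       (2 ^ a' * 3 ^ b' * 5 ^ c' * 7 ^ d' * 11 ^ e' * 13 ^ f' * 17 ^ g') :: real) =
    (real a - real a') * ln 2 + (real b - real b') * ln 3 + (real c - real c') * ln 5
    + (real d - real d') * ln 7 + (real e - real e') * ln 11 + (real f - real f') * ln 13
    + (real g - real g') * ln 17"
  by (simp add: ln_div ln_mult ln_realpow algebra_simps)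

section \<open>Criteria in a form for numerical evaluation\<close>

lemma length_ln_lower: "length ln_lower = 20"
  by (simp add: ln_lower_def)

lemma sum_ln_lower_le_ln:
  assumes "n \<ge> 2" "omega n = k" "1 \<le> k" "k \<le> 20"
  shows "sum_list (take k ln_lower) \<le> ln (real n)"
proof -
  have "length ln_lower = 20" by (simp add: ln_lower_def)
  then have "sum_list (take k ln_lower) = (\<Sum>i<k. ln_lower ! i)"
    using assms(4) by (simp add: sum_list_sum_nth atLeast0LessThan min_def)
  also have "\<dots> \<le> ln (real n)"
    using assms ln_lower_nth by (intro sum_le_ln) auto
  finally show ?thesis .
qed

text \<open>The relaxation criterion for the tabulated weights, with denominators cleared: for
  concrete \<open>k\<close> only arithmetic of rationals and a lower bound for \<open>ln n\<close>
  remain.\<close>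

lemma tau_le_if_ln_lower_le:
  assumes "n \<ge> 2" "omega n = k" "1 \<le> k" "k \<le> 20"
    and g: "0 < g" "g ^ k \<le> prod_list (take k ln_lower)"
    and c: "1 \<le> c * (real k * g)"
    and A: "A \<le> ln (real n)" "A + sum_list (take k ln_lower) \<le> (1 + c * A) * (real k * g)"
  shows "real (tau n) \<le> (1 + c * ln (real n)) ^ k"
proof (rule tau_le_if_relaxed_le[OF assms(1-3), of "\<lambda>i. ln_lower ! i" g c A])
  have len: "length ln_lower = 20" by (simp add: ln_lower_def)
  have pos: "0 < real k * g" using assms by simp
  show "g ^ k \<le> (\<Prod>i<k. ln_lower ! i)"
    using g(2) assms(4) len by (simp add: prod.list_conv_set_nth atLeast0LessThan min_def)
  show "1 / (real k * g) \<le> c" using c pos by (simp add: divide_le_eq)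
  have "sum_list (take k ln_lower) = (\<Sum>i<k. ln_lower ! i)"
    using assms(4) len by (simp add: sum_list_sum_nth atLeast0LessThan min_def)
  then show "(A + (\<Sum>i<k. ln_lower ! i)) / (real k * g) \<le> 1 + c * A"
    using A(2) pos by (simp add: divide_le_eq)
qed (use assms ln_lower_nth in auto)

text \<open>For concrete lists the conditions unfold to linear inequalities in logarithms.
  Monotonicity of \<open>ln\<close> allows \<open>y\<close> and \<open>z\<close>, whose logarithms
  are accessible, to stand in for the values at the end points.\<close>

lemma tau_le_if_tangent_list_le:
  assumes n: "n \<ge> 2" "omega n = k" and k: "k \<le> 20" and t: "0 \<le> t"
    and b: "list_all2 (\<lambda>p b. 1 \<le> b
        \<and> ln (real b + 2) - ln (real b + 1) \<le> t * ln (real p)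
        \<and> (b = 1 \<or> t * ln (real p) \<le> ln (real b + 1) - ln (real b))) (take k small_primes) bs"
    and c: "0 \<le> c" and AB: "0 \<le> A" "A \<le> ln (real n)" "ln (real n) \<le> B"
    and y: "0 < y" "y \<le> 1 + c * A"
      "(\<Sum>(p, b)\<leftarrow>zip (take k small_primes) bs. ln (real b + 1) - t * (real b * ln (real p))) + t * A
        \<le> real k * ln y"
    and z: "0 < z" "z \<le> 1 + c * B"
      "(\<Sum>(p, b)\<leftarrow>zip (take k small_primes) bs. ln (real b + 1) - t * (real b * ln (real p))) + t * B
        \<le> real k * ln z"
  shows "real (tau n) \<le> (1 + c * ln (real n)) ^ k"
proof -
  have len: "length small_primes = 20" by (simp add: small_primes_def)
  then have lens: "length bs = k" using list_all2_lengthD[OF b] k by simp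
  have p: "take k small_primes ! i = nth_prime (Suc i)" if "i < k" for i
    using that k by (simp add: nth_prime_eq_small_primes)
  let ?C = "\<Sum>(p, b)\<leftarrow>zip (take k small_primes) bs. ln (real b + 1) - t * (real b * ln (real p))"
  have C: "?C = (\<Sum>i<k. ln (real (bs ! i) + 1) - t * (real (bs ! i) * ln (real (nth_prime (Suc i)))))"
    using len lens k p by (auto simp: sum_list_sum_nth atLeast0LessThan intro!: sum.cong)
  have "real k * ln y \<le> real k * ln (1 + c * A)" "real k * ln z \<le> real k * ln (1 + c * B)"
    using y z by (auto intro!: mult_left_mono)
  with y z have "?C + t * A \<le> real k * ln (1 + c * A)" "?C + t * B \<le> real k * ln (1 + c * B)"
    by linarith+
  then show ?thesis
    using list_all2_nthD2[OF b] lens p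
    by (intro tau_le_if_tangent_le[OF n t _ _ _ C c AB]) auto
qed

subsection \<open>The value of the constant\<close>

lemma prime_factors_prod_prime_powers:
  fixes e :: "nat \<Rightarrow> nat"
  assumes "finite S" "\<And>p. p \<in> S \<Longrightarrow> prime p" "\<And>p. p \<in> S \<Longrightarrow> 0 < e p"
  shows "prime_factors (\<Prod>p\<in>S. p ^ e p) = S"
proof -
  have "(\<Prod>p\<in>S. p ^ e p) \<noteq> 0" using assms(1) assms(2)[of 0] by auto
  moreover have "prime q \<and> q dvd (\<Prod>p\<in>S. p ^ e p) \<longleftrightarrow> q \<in> S" for q
    using assms by (auto simp: prime_dvd_prod_iff prime_dvd_power_iff)
      (metis primes_dvd_imp_eq, metis dvd_refl)
  ultimately show ?thesis by (simp add: prime_factors_dvd)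
qed

lemma eta3_eq: "eta3 = ((1152::real) powr (1 / 7) - 1) * 7 * ln 7 / ln 367567200"
proof -
  let ?S = "{2, 3, 5, 7, 11, 13, 17} :: nat set"
  \<comment> \<open>The factor 720 = 2^4 * 3^2 * 5 raises the exponents of 2, 3, 5 in the product of
    the first seven primes to 5, 3, 2.\<close>
  define e :: "nat \<Rightarrow> nat" where "e p = (if p = 2 then 5 else if p = 3 then 3 else if p = 5 then 2 else 1)" for p
  have N: "(\<Prod>p\<in>?S. p ^ e p) = 367567200" by (simp add: e_def)
  have primes: "\<And>p. p \<in> ?S \<Longrightarrow> prime p" by auto
  have "tau 367567200 = 1152"
    using tau_prod_prime_powers[of ?S e, OF _ primes] by (simp add: N e_def)
  moreover have "omega 367567200 = 7"
    using prime_factors_prod_prime_powers[of ?S e, OF _ primes]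
    by (simp add: N) (simp add: omega_def e_def)
  moreover have "(\<Prod>i=1..7. nth_prime i) = 510510"
  proof -
    have "(\<Prod>i=1..7. nth_prime i) = (\<Prod>i<7. nth_prime (Suc i))"
      by (rule prod.reindex_bij_witness[of _ Suc "\<lambda>i. i - 1"]) auto
    also have "\<dots> = (\<Prod>i<7. small_primes ! i)"
      by (intro prod.cong) (auto simp: nth_prime_eq_small_primes)
    finally show ?thesis by (simp add: small_primes_def lessThan_nat_numeral lessThan_Suc)
  qed
  ultimately show ?thesis by (simp add: eta3_def lambda_def)
qed

lemma eta3_bounds: "1.1999953 \<le> eta3" "eta3 < 1.1999954"
proof -
  define r :: real where "r = 1152 powr (1 / 7)"
  have r7: "r ^ 7 = 1152" "0 \<le> r" by (simp_all add: r_def powr_power)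
  \<comment> \<open>Seventh powers are compared; the argument 6 stands for the exponent
    \<open>Suc 6\<close>.\<close>
  have r: "2.7374762132 \<le> r" "r \<le> 2.7374762133"
    using r7 power_le_imp_le_base[of "2.7374762132" 6 r] power_le_imp_le_base[of r 6 "2.7374762133"]
    by (simp_all add: power_divide)
  have N: "ln (367567200::real) = 5 * ln 2 + 3 * ln 3 + 2 * ln 5 + ln 7 + ln 11 + ln 13 + ln 17"
    using ln_smooth_quotient[of 5 3 2 1 1 1 1 0 0 0 0 0 0 0] by simp
  have N_bounds: "19.722416714 \<le> ln (367567200::real)" "ln (367567200::real) \<le> 19.722416719"
    unfolding N using ln_prime_bounds by simp_all
  have eta: "eta3 = (r - 1) * 7 * ln 7 / ln 367567200" by (simp add: eta3_eq r_def)
  have "1.1999953 * ln (367567200::real) \<le> (2.7374762132 - 1) * 7 * 1.9459101489"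
    using N_bounds by simp
  also have "\<dots> \<le> (r - 1) * 7 * ln 7"
    using r ln7 by (intro mult_mono) auto
  finally show "1.1999953 \<le> eta3" using N_bounds unfolding eta by (subst pos_le_divide_eq) auto
  have "(r - 1) * 7 * ln 7 \<le> (2.7374762133 - 1) * 7 * 1.9459101493"
    using r ln7 by (intro mult_mono) auto
  also have "\<dots> < 1.1999954 * ln (367567200::real)"
    using N_bounds by simp
  finally show "eta3 < 1.1999954" using N_bounds unfolding eta by (subst pos_divide_less_eq) auto
qed

subsection \<open>Fewer than twenty prime factors\<close>

text \<open>
  The break points and slopes \<open>t\<close> come from a numerical search; \<open>t\<close> determines the exponents, by
  \<open>b\<^sub>i = max 1 \<lfloor>1 / (p\<^sub>i powr t - 1)\<rfloor>\<close>. The factor in front of \<open>ln n\<close> is a lower bound for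
  \<open>eta3 / (k ln k)\<close>. The values \<open>y\<close> and \<open>z\<close>, slightly smaller than \<open>1 + c A\<close> and \<open>1 + c B\<close>, are quotients
  of numbers without prime factors above 17, so that their logarithms are integer
  combinations of those of the first seven primes.
\<close>

lemma tau_le_omega_1:
  assumes "n \<ge> 2" "omega n = 1"
  shows "real (tau n) \<le> (1 + 1.5 * ln (real n)) ^ 1"
  \<comment> \<open>Here \<open>log_plus 1 = ln 2\<close>, so factors up to
    \<open>eta3 / ln 2\<close>, about 1.73, are admissible. At \<open>A = 0\<close> the criterion
    holds with equality.\<close>
  by (rule tau_le_if_ln_lower_le[OF assms, where g = "0.6931" and A = 0])
    (use assms in \<open>simp_all add: ln_lower_def\<close>)

text \<open>\<open>A\<close> is the sum of the weights, hence a lower bound for every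
  \<open>ln n\<close> in question, and \<open>g\<close> lies just below their geometric mean. The
  same choice works for 3 and 4.\<close>

lemma tau_le_omega_2:
  assumes "n \<ge> 2" "omega n = 2"
  shows "real (tau n) \<le> (1 + 0.8656136 * ln (real n)) ^ 2"
  by (rule tau_le_if_ln_lower_le[OF assms, where g = "0.8726" and A = "1.7917"])
    (use sum_ln_lower_le_ln[OF assms] in \<open>simp_all add: ln_lower_def power_divide\<close>)

lemma tau_le_omega_3:
  assumes "n \<ge> 2" "omega n = 3"
  shows "real (tau n) \<le> (1 + 0.3640942 * ln (real n)) ^ 3"
  by (rule tau_le_if_ln_lower_le[OF assms, where g = "1.07012" and A = "3.4011"])
    (use sum_ln_lower_le_ln[OF assms] in \<open>simp_all add: ln_lower_def power_divide\<close>)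

lemma tau_le_omega_4:
  assumes "n \<ge> 2" "omega n = 4"
  shows "real (tau n) \<le> (1 + 0.2164034 * ln (real n)) ^ 4"
  by (rule tau_le_if_ln_lower_le[OF assms, where g = "1.24266" and A = "5.347"])
    (use sum_ln_lower_le_ln[OF assms] in \<open>simp_all add: ln_lower_def power_divide\<close>)

text \<open>Near the smallest \<open>ln n\<close> the relaxed bound is too large; it takes over at
  11.7. Before that a tangent is used, exact at 2^4 * 3^2 * 5 * 7 * 11, whose logarithm is about
  10.92. The cases up to 13 follow this plan, some with several tangents.\<close>

lemma tau_le_omega_5:
  assumes n: "n \<ge> 2" "omega n = 5"
  shows "real (tau n) \<le> (1 + 0.1491198 * ln (real n)) ^ 5"
proof -
  have lower: "7.74 \<le> ln (real n)"
    using sum_ln_lower_le_ln[OF n] by (simp add: ln_lower_def)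
  have ?thesis if "ln (real n) \<le> 11.7"
    by (rule tau_le_if_tangent_list_le[OF n, where bs = "[4, 2, 1, 1, 1]" and t = "0.3"
          and A = "7.74" and y = "28 / 13" and B = "11.7" and z = "96 / 35"];
        (simp add: small_primes_def ln_composites
          ln_smooth_quotient[of 2 0 0 1 0 0 0 0 0 0 0 0 1 0, simplified]
          ln_smooth_quotient[of 5 1 0 0 0 0 0 0 0 1 1 0 0 0, simplified])?;
        (intro conjI)?; use lower that ln_prime_bounds in simp)
  moreover have ?thesis if "11.7 \<le> ln (real n)"
    by (rule tau_le_if_ln_lower_le[OF n, where g = "1.41725" and A = "11.7"])
      (use that in \<open>simp_all add: ln_lower_def power_divide\<close>)
  ultimately show ?thesis by linarith
qed

lemma tau_le_omega_6:
  assumes n: "n \<ge> 2" "omega n = 6"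
  shows "real (tau n) \<le> (1 + 0.1116216 * ln (real n)) ^ 6"
proof -
  have lower: "10.3 \<le> ln (real n)"
    using sum_ln_lower_le_ln[OF n] by (simp add: ln_lower_def)
  have ?thesis if "ln (real n) \<le> 14.8"
    by (rule tau_le_if_tangent_list_le[OF n, where bs = "[4, 2, 1, 1, 1, 1]" and t = "0.28"
          and A = "10.3" and y = "260 / 121" and B = "14.8" and z = "175 / 66"];
        (simp add: small_primes_def ln_composites
          ln_smooth_quotient[of 2 0 1 0 0 1 0 0 0 0 0 2 0 0, simplified]
          ln_smooth_quotient[of 0 0 2 1 0 0 0 1 1 0 0 1 0 0, simplified])?;
        (intro conjI)?; use lower that ln_prime_bounds in simp)
  \<comment> \<open>For larger \<open>n\<close> the line has to be flatter, and a smaller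
    \<open>t\<close> goes with larger exponents.\<close>
  moreover have ?thesis if "14.8 \<le> ln (real n)" "ln (real n) \<le> 16.9"
    by (rule tau_le_if_tangent_list_le[OF n, where bs = "[5, 3, 2, 1, 1, 1]" and t = "0.242"
          and A = "14.8" and y = "175 / 66" and B = "16.9" and z = "990 / 343"];
        (simp add: small_primes_def ln_composites
          ln_smooth_quotient[of 0 0 2 1 0 0 0 1 1 0 0 1 0 0, simplified]
          ln_smooth_quotient[of 1 2 1 0 1 0 0 0 0 0 3 0 0 0, simplified])?;
        (intro conjI)?; use lower that ln_prime_bounds in simp)
  moreover have ?thesis if "16.9 \<le> ln (real n)" "ln (real n) \<le> 19.3"
    by (rule tau_le_if_tangent_list_le[OF n, where bs = "[6, 3, 2, 1, 1, 1]" and t = "0.222"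
          and A = "16.9" and y = "990 / 343" and B = "19.3" and z = "1700 / 539"];
        (simp add: small_primes_def ln_composites
          ln_smooth_quotient[of 1 2 1 0 1 0 0 0 0 0 3 0 0 0, simplified]
          ln_smooth_quotient[of 2 0 2 0 0 0 1 0 0 0 2 1 0 0, simplified])?;
        (intro conjI)?; use lower that ln_prime_bounds in simp)
  moreover have ?thesis if "19.3 \<le> ln (real n)"
    by (rule tau_le_if_ln_lower_le[OF n, where g = "1.56453" and A = "19.3"])
      (use that in \<open>simp_all add: ln_lower_def power_divide\<close>)
  ultimately show ?thesis by linarith
qed

text \<open>The extremal case. The equation for \<open>c\<close> says that the bound is attained at
  367567200, so a rational approximation from below cannot replace \<open>c\<close> there.\<close>

lemma tau_le_omega_7:
  assumes n: "n \<ge> 2" "omega n = 7"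
    and c: "0.0880965 \<le> c" "7 * ln (1 + c * ln 367567200) = ln 1152"
  shows "real (tau n) \<le> (1 + c * ln (real n)) ^ 7"
proof -
  have lower: "13.13 \<le> ln (real n)"
    using sum_ln_lower_le_ln[OF n] by (simp add: ln_lower_def)
  define M :: real where "M = ln 367567200"
  have M: "5 * ln 2 + 3 * ln 3 + 2 * ln 5 + ln 7 + ln 11 + ln 13 + ln 17 = M"
    unfolding M_def using ln_smooth_quotient[of 5 3 2 1 1 1 1 0 0 0 0 0 0 0] by simp
  have M_pos: "0 < M" by (simp add: M_def)
  have vertex: "7 * ln (1 + c * M) = 7 * ln 2 + 2 * ln 3"
    using c(2) ln_smooth_quotient[of 7 2 0 0 0 0 0 0 0 0 0 0 0 0] by (simp add: M_def)
  have "0 < 1 + c * M" using c(1) M_pos by (simp add: add_pos_nonneg)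
  note M = M M_pos vertex this
  \<comment> \<open>At the other end points there is slack, and the rational lower bound for
    \<open>c\<close> suffices.\<close>
  have scale: "1 + 0.0880965 * x \<le> 1 + c * x" if "0 \<le> x" for x
    using mult_right_mono[OF c(1) that] by simp
  have ?thesis if "ln (real n) \<le> 16.6"
    by (rule tau_le_if_tangent_list_le[OF n, where bs = "[4, 2, 1, 1, 1, 1, 1]" and t = "0.268"
          and A = "13.13" and y = "15 / 7" and B = "16.6" and z = "27 / 11"];
        (simp add: small_primes_def ln_composites
          ln_smooth_quotient[of 0 1 1 0 0 0 0 0 0 0 1 0 0 0, simplified]
          ln_smooth_quotient[of 0 3 0 0 0 0 0 0 0 0 0 1 0 0, simplified])?;
        (intro conjI)?; use lower that c(1) scale[of "13.13"] scale[of "16.6"] ln_prime_bounds in simp)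
  \<comment> \<open>This piece and the next have the same exponents, so both lines pass through the
    extremal point at \<open>M\<close>. Their slopes 0.25 and 0.223 lie on either side of the
    derivative of \<open>7 * ln (1 + c * L)\<close> at \<open>M\<close>, about 0.2253, as concavity
    demands.\<close>
  moreover have ?thesis if "16.6 \<le> ln (real n)" "ln (real n) \<le> M"
    by (rule tau_le_if_tangent_list_le[OF n, where bs = "[5, 3, 2, 1, 1, 1, 1]" and t = "0.25"
          and A = "16.6" and y = "27 / 11" and B = "M" and z = "1 + c * M"];
        (simp add: small_primes_def ln_composites
          ln_smooth_quotient[of 0 3 0 0 0 0 0 0 0 0 0 1 0 0, simplified])?;
        (intro conjI)?; use lower that M c(1) scale[of "16.6"] ln_prime_bounds in simp)
  moreover have ?thesis if "M \<le> ln (real n)" "ln (real n) \<le> 20.3"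
    by (rule tau_le_if_tangent_list_le[OF n, where bs = "[5, 3, 2, 1, 1, 1, 1]" and t = "0.223"
          and A = "M" and y = "1 + c * M" and B = "20.3" and z = "40824 / 14641"];
        (simp add: small_primes_def ln_composites
          ln_smooth_quotient[of 3 6 0 1 0 0 0 0 0 0 0 4 0 0, simplified])?;
        (intro conjI)?; use lower that M c(1) scale[of "20.3"] ln_prime_bounds in simp)
  moreover have ?thesis if "20.3 \<le> ln (real n)" "ln (real n) \<le> 20.68"
    by (rule tau_le_if_tangent_list_le[OF n, where bs = "[6, 3, 2, 1, 1, 1, 1]" and t = "0.22"
          and A = "20.3" and y = "40824 / 14641" and B = "20.68" and z = "36720 / 13013"];
        (simp add: small_primes_def ln_composites
          ln_smooth_quotient[of 3 6 0 1 0 0 0 0 0 0 0 4 0 0, simplified]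
          ln_smooth_quotient[of 4 3 1 0 0 0 1 0 0 0 1 1 2 0, simplified])?;
        (intro conjI)?; use lower that c(1) scale[of "20.3"] scale[of "20.68"] ln_prime_bounds in simp)
  moreover have ?thesis if "20.68 \<le> ln (real n)" "ln (real n) \<le> 24.33"
    by (rule tau_le_if_tangent_list_le[OF n, where bs = "[6, 3, 2, 2, 1, 1, 1]" and t = "0.207"
          and A = "20.68" and y = "2057 / 729" and B = "24.33" and z = "3536 / 1125"];
        (simp add: small_primes_def ln_composites
          ln_smooth_quotient[of 0 0 0 0 2 0 1 0 6 0 0 0 0 0, simplified]
          ln_smooth_quotient[of 4 0 0 0 0 1 1 0 2 3 0 0 0 0, simplified])?;
        (intro conjI)?; use lower that c(1) scale[of "20.68"] scale[of "24.33"] ln_prime_bounds in simp)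
  moreover have ?thesis if "24.33 \<le> ln (real n)"
    by (rule tau_le_if_ln_lower_le[OF n, where g = "1.70304" and A = "24.33"])
      (use that c(1) in \<open>simp_all add: ln_lower_def power_divide\<close>)
  ultimately show ?thesis by linarith
qed

text \<open>From here on primes above 17 enter, with only lower bounds for their logarithms. Their
  exponent is 1 in every tangent: then the slope condition bounds \<open>t * ln p\<close> only from
  below, and \<open>ln p\<close> enters the intercept with a negative sign.\<close>

lemma tau_le_omega_8:
  assumes n: "n \<ge> 2" "omega n = 8"
  shows "real (tau n) \<le> (1 + 0.0721344 * ln (real n)) ^ 8"
proof -
  have lower: "16.08 \<le> ln (real n)"
    using sum_ln_lower_le_ln[OF n] by (simp add: ln_lower_def)
  have ?thesis if "ln (real n) \<le> 22.9"
    by (rule tau_le_if_tangent_list_le[OF n, where bs = "[5, 3, 2, 1, 1, 1, 1, 1]" and t = "0.242"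
          and A = "16.08" and y = "136 / 63" and B = "22.9" and z = "175 / 66"];
        (simp add: small_primes_def ln_composites
          ln_smooth_quotient[of 3 0 0 0 0 0 1 0 2 0 1 0 0 0, simplified]
          ln_smooth_quotient[of 0 0 2 1 0 0 0 1 1 0 0 1 0 0, simplified])?;
        (intro conjI)?; use lower that ln_prime_bounds ln19 in simp)
  moreover have ?thesis if "22.9 \<le> ln (real n)" "ln (real n) \<le> 25.7"
    by (rule tau_le_if_tangent_list_le[OF n, where bs = "[6, 3, 2, 1, 1, 1, 1, 1]" and t = "0.21"
          and A = "22.9" and y = "175 / 66" and B = "25.7" and z = "4851 / 1700"];
        (simp add: small_primes_def ln_composites
          ln_smooth_quotient[of 0 0 2 1 0 0 0 1 1 0 0 1 0 0, simplified]
          ln_smooth_quotient[of 0 2 0 2 1 0 0 2 0 2 0 0 0 1, simplified])?;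
        (intro conjI)?; use lower that ln_prime_bounds ln19 in simp)
  moreover have ?thesis if "25.7 \<le> ln (real n)" "ln (real n) \<le> 28.59"
    by (rule tau_le_if_tangent_list_le[OF n, where bs = "[6, 4, 2, 2, 1, 1, 1, 1]" and t = "0.194"
          and A = "25.7" and y = "5525 / 1936" and B = "28.59" and z = "150 / 49"];
        (simp add: small_primes_def ln_composites
          ln_smooth_quotient[of 0 0 2 0 0 1 1 4 0 0 0 2 0 0, simplified]
          ln_smooth_quotient[of 1 1 2 0 0 0 0 0 0 0 2 0 0 0, simplified])?;
        (intro conjI)?; use lower that ln_prime_bounds ln19 in simp)
  moreover have ?thesis if "28.59 \<le> ln (real n)"
    by (rule tau_le_if_ln_lower_le[OF n, where g = "1.82367" and A = "28.59"])
      (use that in \<open>simp_all add: ln_lower_def power_divide\<close>)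
  ultimately show ?thesis by linarith
qed

lemma tau_le_omega_9:
  assumes n: "n \<ge> 2" "omega n = 9"
  shows "real (tau n) \<le> (1 + 0.0606823 * ln (real n)) ^ 9"
proof -
  have lower: "19.22 \<le> ln (real n)"
    using sum_ln_lower_le_ln[OF n] by (simp add: ln_lower_def)
  have ?thesis if "ln (real n) \<le> 27.1"
    by (rule tau_le_if_tangent_list_le[OF n, where bs = "[5, 3, 2, 1, 1, 1, 1, 1, 1]" and t = "0.228"
          and A = "19.22" and y = "119 / 55" and B = "27.1" and z = "66 / 25"];
        (simp add: small_primes_def ln_composites
          ln_smooth_quotient[of 0 0 0 1 0 0 1 0 0 1 0 1 0 0, simplified]
          ln_smooth_quotient[of 1 1 0 0 1 0 0 0 0 2 0 0 0 0, simplified])?;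
        (intro conjI)?; use lower that ln_prime_bounds ln19 ln23 in simp)
  moreover have ?thesis if "27.1 \<le> ln (real n)" "ln (real n) \<le> 31.0"
    by (rule tau_le_if_tangent_list_le[OF n, where bs = "[6, 4, 2, 2, 1, 1, 1, 1, 1]" and t = "0.198"
          and A = "27.1" and y = "119 / 45" and B = "31.0" and z = "72 / 25"];
        (simp add: small_primes_def ln_composites
          ln_smooth_quotient[of 0 0 0 1 0 0 1 0 2 1 0 0 0 0, simplified]
          ln_smooth_quotient[of 3 2 0 0 0 0 0 0 0 2 0 0 0 0, simplified])?;
        (intro conjI)?; use lower that ln_prime_bounds ln19 ln23 in simp)
  moreover have ?thesis if "31.0 \<le> ln (real n)"
    by (rule tau_le_if_ln_lower_le[OF n, where g = "1.93685" and A = "31.0"])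
      (use that in \<open>simp_all add: ln_lower_def power_divide\<close>)
  ultimately show ?thesis by linarith
qed

lemma tau_le_omega_10:
  assumes n: "n \<ge> 2" "omega n = 10"
  shows "real (tau n) \<le> (1 + 0.0521151 * ln (real n)) ^ 10"
proof -
  have lower: "22.58 \<le> ln (real n)"
    using sum_ln_lower_le_ln[OF n] by (simp add: ln_lower_def)
  have ?thesis if "ln (real n) \<le> 31.8"
    by (rule tau_le_if_tangent_list_le[OF n, where bs = "[6, 3, 2, 1, 1, 1, 1, 1, 1, 1]" and t = "0.21"
          and A = "22.58" and y = "176 / 81" and B = "31.8" and z = "45 / 17"];
        (simp add: small_primes_def ln_composites
          ln_smooth_quotient[of 4 0 0 0 1 0 0 0 4 0 0 0 0 0, simplified]
          ln_smooth_quotient[of 0 2 1 0 0 0 0 0 0 0 0 0 0 1, simplified])?;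
        (intro conjI)?; use lower that ln_prime_bounds ln19 ln23 ln29 in simp)
  moreover have ?thesis if "31.8 \<le> ln (real n)"
    by (rule tau_le_if_ln_lower_le[OF n, where g = "2.04698" and A = "31.8"])
      (use that in \<open>simp_all add: ln_lower_def power_divide\<close>)
  ultimately show ?thesis by linarith
qed

lemma tau_le_omega_11:
  assumes n: "n \<ge> 2" "omega n = 11"
  shows "real (tau n) \<le> (1 + 0.0454942 * ln (real n)) ^ 11"
proof -
  have lower: "26.02 \<le> ln (real n)"
    using sum_ln_lower_le_ln[OF n] by (simp add: ln_lower_def)
  have ?thesis if "ln (real n) \<le> 32.9"
    by (rule tau_le_if_tangent_list_le[OF n, where bs = "[6, 4, 2, 2, 1, 1, 1, 1, 1, 1, 1]" and t = "0.2"
          and A = "26.02" and y = "24 / 11" and B = "32.9" and z = "42 / 17"];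
        (simp add: small_primes_def ln_composites
          ln_smooth_quotient[of 3 1 0 0 0 0 0 0 0 0 0 1 0 0, simplified]
          ln_smooth_quotient[of 1 1 0 1 0 0 0 0 0 0 0 0 0 1, simplified])?;
        (intro conjI)?; use lower that ln_prime_bounds ln19 ln23 ln29 ln31 in simp)
  moreover have ?thesis if "32.9 \<le> ln (real n)"
    by (rule tau_le_if_ln_lower_le[OF n, where g = "2.14555" and A = "32.9"])
      (use that in \<open>simp_all add: ln_lower_def power_divide\<close>)
  ultimately show ?thesis by linarith
qed

lemma tau_le_omega_12:
  assumes n: "n \<ge> 2" "omega n = 12"
  shows "real (tau n) \<le> (1 + 0.0402428 * ln (real n)) ^ 12"
proof -
  have lower: "29.63 \<le> ln (real n)"
    using sum_ln_lower_le_ln[OF n] by (simp add: ln_lower_def)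
  have ?thesis if "ln (real n) \<le> 33.5"
    by (rule tau_le_if_tangent_list_le[OF n, where bs = "[7, 4, 2, 2, 1, 1, 1, 1, 1, 1, 1, 1]" and t = "0.19"
          and A = "29.63" and y = "24 / 11" and B = "33.5" and z = "7 / 3"];
        (simp add: small_primes_def ln_composites
          ln_smooth_quotient[of 3 1 0 0 0 0 0 0 0 0 0 1 0 0, simplified]
          ln_smooth_quotient[of 0 0 0 1 0 0 0 0 1 0 0 0 0 0, simplified])?;
        (intro conjI)?; use lower that ln_prime_bounds ln19 ln23 ln29 ln31 ln37 in simp)
  moreover have ?thesis if "33.5 \<le> ln (real n)"
    by (rule tau_le_if_ln_lower_le[OF n, where g = "2.24067" and A = "33.5"])
      (use that in \<open>simp_all add: ln_lower_def power_divide\<close>)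
  ultimately show ?thesis by linarith
qed

text \<open>Only the short interval from 33.34 to 34.2 is left to a tangent.\<close>

lemma tau_le_omega_13:
  assumes n: "n \<ge> 2" "omega n = 13"
  shows "real (tau n) \<le> (1 + 0.0359879 * ln (real n)) ^ 13"
proof -
  have lower: "33.34 \<le> ln (real n)"
    using sum_ln_lower_le_ln[OF n] by (simp add: ln_lower_def)
  have ?thesis if "ln (real n) \<le> 34.2"
    by (rule tau_le_if_tangent_list_le[OF n, where bs = "[7, 4, 2, 2, 1, 1, 1, 1, 1, 1, 1, 1, 1]" and t = "0.18"
          and A = "33.34" and y = "35 / 16" and B = "34.2" and z = "20 / 9"];
        (simp add: small_primes_def ln_composites
          ln_smooth_quotient[of 0 0 1 1 0 0 0 4 0 0 0 0 0 0, simplified]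
          ln_smooth_quotient[of 2 0 1 0 0 0 0 0 2 0 0 0 0 0, simplified])?;
        (intro conjI)?; use lower that ln_prime_bounds ln19 ln23 ln29 ln31 ln37 ln41 in simp)
  moreover have ?thesis if "34.2 \<le> ln (real n)"
    by (rule tau_le_if_ln_lower_le[OF n, where g = "2.32946" and A = "34.2"])
      (use that in \<open>simp_all add: ln_lower_def power_divide\<close>)
  ultimately show ?thesis by linarith
qed

text \<open>From here on the relaxation holds already at the sum of the weights, which is again
  taken as \<open>A\<close>.\<close>

lemma tau_le_omega_14:
  assumes "n \<ge> 2" "omega n = 14"
  shows "real (tau n) \<le> (1 + 0.032479 * ln (real n)) ^ 14"
  by (rule tau_le_if_ln_lower_le[OF assms, where g = "2.41055" and A = "37.1093"])
    (use sum_ln_lower_le_ln[OF assms] in \<open>simp_all add: ln_lower_def power_divide\<close>)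

lemma tau_le_omega_15:
  assumes "n \<ge> 2" "omega n = 15"
  shows "real (tau n) \<le> (1 + 0.0295414 * ln (real n)) ^ 15"
  by (rule tau_le_if_ln_lower_le[OF assms, where g = "2.48698" and A = "40.9593"])
    (use sum_ln_lower_le_ln[OF assms] in \<open>simp_all add: ln_lower_def power_divide\<close>)

lemma tau_le_omega_16:
  assumes "n \<ge> 2" "omega n = 16"
  shows "real (tau n) \<le> (1 + 0.0270504 * ln (real n)) ^ 16"
  by (rule tau_le_if_ln_lower_le[OF assms, where g = "2.56076" and A = "44.9295"])
    (use sum_ln_lower_le_ln[OF assms] in \<open>simp_all add: ln_lower_def power_divide\<close>)

lemma tau_le_omega_17:
  assumes "n \<ge> 2" "omega n = 17"
  shows "real (tau n) \<le> (1 + 0.0249144 * ln (real n)) ^ 17"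
  by (rule tau_le_if_ln_lower_le[OF assms, where g = "2.63179" and A = "49.0069"])
    (use sum_ln_lower_le_ln[OF assms] in \<open>simp_all add: ln_lower_def power_divide\<close>)

lemma tau_le_omega_18:
  assumes "n \<ge> 2" "omega n = 18"
  shows "real (tau n) \<le> (1 + 0.0230649 * ln (real n)) ^ 18"
  by (rule tau_le_if_ln_lower_le[OF assms, where g = "2.69781" and A = "53.1177"])
    (use sum_ln_lower_le_ln[OF assms] in \<open>simp_all add: ln_lower_def power_divide\<close>)

lemma tau_le_omega_19:
  assumes "n \<ge> 2" "omega n = 19"
  shows "real (tau n) \<le> (1 + 0.02144 * ln (real n)) ^ 19"
  by (rule tau_le_if_ln_lower_le[OF assms, where g = "2.76156" and A = "57.3223"])
    (use sum_ln_lower_le_ln[OF assms] in \<open>simp_all add: ln_lower_def power_divide\<close>)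

subsection \<open>At least twenty prime factors\<close>

text \<open>The coefficient 1 from \<open>exp_bound\<close> would be too weak for the product
  estimate below; integrating that bound once yields 0.7. The range covers \<open>1 / u\<close> for
  \<open>u\<close> at least 2.79.\<close>

lemma exp_le_quadratic:
  fixes x :: real
  assumes "0 \<le> x" "x \<le> 0.4"
  shows "exp x \<le> 1 + x + 0.7 * x\<^sup>2"
proof -
  let ?f = "\<lambda>x::real. 1 + x + 0.7 * x\<^sup>2 - exp x"
  have "?f 0 \<le> ?f x"
  proof (rule DERIV_nonneg_imp_nondecreasing[OF assms(1)])
    fix y assume y: "0 \<le> y" "y \<le> x"
    have "exp y \<le> 1 + y + y\<^sup>2" using y assms by (intro exp_bound) auto
    also have "y\<^sup>2 \<le> 0.4 * y"
      unfolding power2_eq_square using y assms by (intro mult_right_mono) auto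
    finally have "0 \<le> 1 + 1.4 * y - exp y" by simp
    moreover have "(?f has_real_derivative 1 + 1.4 * y - exp y) (at y)"
      by (auto intro!: derivative_eq_intros)
    ultimately show "\<exists>d. (?f has_real_derivative d) (at y) \<and> 0 \<le> d" by blast
  qed
  then show ?thesis by simp
qed

text \<open>Weights for \<open>k\<close> at least 20. Index \<open>i\<close> belongs to prime number
  \<open>i + 1\<close>, hence \<open>Suc i\<close>.\<close>

definition ln_prime_lower :: "nat \<Rightarrow> real" where
  "ln_prime_lower i = (if i < 20 then ln_lower ! i else ln (3 * real (Suc i)))"

lemma ln_prime_lower: "0 < ln_prime_lower i" "ln_prime_lower i \<le> ln (real (nth_prime (Suc i)))"
proof -
  have "3 * real (Suc i) \<le> real (nth_prime (Suc i))" if "i \<ge> 20"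
    using nth_prime_ge_3_mult[of "Suc i"] that by linarith
  then show "0 < ln_prime_lower i" "ln_prime_lower i \<le> ln (real (nth_prime (Suc i)))"
    using ln_lower_nth[of i] by (auto simp: ln_prime_lower_def)
qed

lemma ln_20_bounds: "2.9957 \<le> ln (20::real)" "ln (20::real) \<le> 2.9958"
  using ln2 ln5 by (simp_all add: ln_composites)

lemma ln_ge_if_ge_20:
  assumes "k \<ge> 20"
  shows "2.9957 \<le> ln (real k)"
proof -
  have "ln 20 \<le> ln (real k)" using assms by simp
  then show ?thesis using ln_20_bounds(1) by linarith
qed

text \<open>From \<open>k\<close> to \<open>k + 1\<close> the right side gains at least
  \<open>ln (k + 1) + 40 / 41 + 0.13\<close>, the left side \<open>ln (k + 1) + ln 3\<close>. It is
  this step that dictates 0.13; the base case has more room.\<close>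

lemma sum_ln_prime_lower_le:
  assumes "k \<ge> 20"
  shows "(\<Sum>i<k. ln_prime_lower i) \<le> real k * (ln (real k) + 0.13)"
  using assms
proof (induction k rule: dec_induct)
  case base
  have "(\<Sum>i<20. ln_prime_lower i) = (\<Sum>i<20. ln_lower ! i)"
    by (intro sum.cong) (auto simp: ln_prime_lower_def)
  also have "\<dots> = sum_list ln_lower"
    by (simp add: sum_list_sum_nth atLeast0LessThan length_ln_lower)
  also have "\<dots> \<le> 20 * (ln 20 + 0.13)"
    using ln_20_bounds by (simp add: ln_lower_def)
  finally show ?case by simp
next
  case (step k)
  have "1 - 1 / (2 * real k + 1) = real k * (2 / (2 * real k + 1))"
    by (simp add: field_simps)
  also have "\<dots> \<le> real k * (ln (real k + 1) - ln (real k))"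
    using ln_add_one_ge[of "real k"] step.hyps by (intro mult_left_mono) auto
  finally have "1 - 1 / (2 * real k + 1) \<le> real k * (ln (real k + 1) - ln (real k))" .
  moreover have "1 / (2 * real k + 1) \<le> 1 / 41"
    using step.hyps by (intro divide_left_mono) auto
  ultimately have "1 - 1 / 41 \<le> real k * (ln (real k + 1) - ln (real k))" by linarith
  moreover have "real (Suc k) * (ln (real (Suc k)) + 0.13) = real k * (ln (real k) + 0.13)
      + real k * (ln (real k + 1) - ln (real k)) + ln (real k + 1) + 0.13"
    by (simp add: algebra_simps)
  moreover have "ln (3 * real (Suc k)) = ln 3 + ln (real k + 1)"
    by (subst ln_mult) (auto simp: add.commute)
  ultimately show ?case
    using step.IH step.hyps ln3 by (simp add: ln_prime_lower_def[of k])
qed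

text \<open>A lower bound for the geometric mean of the weights. With \<open>u\<close> and
  \<open>v\<close> the bases for \<open>k\<close> and \<open>k + 1\<close>, the step amounts to
  \<open>v * (v / u) ^ k\<close> being at most the new weight \<open>v + 0.2 + ln 3\<close>; here
  \<open>(v / u) ^ k\<close> is at most \<open>exp (1 / u)\<close>.\<close>

lemma prod_ln_prime_lower_ge:
  assumes "k \<ge> 20"
  shows "(ln (real k) - 0.2) ^ k \<le> (\<Prod>i<k. ln_prime_lower i)"
  using assms
proof (induction k rule: dec_induct)
  case base
  have "(ln 20 - 0.2) ^ 20 \<le> (2.7958 :: real) ^ 20"
    using ln_20_bounds by (intro power_mono) auto
  also have "\<dots> \<le> prod_list ln_lower"
    by (simp add: ln_lower_def power_divide)
  also have "\<dots> = (\<Prod>i<20. ln_lower ! i)"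
    by (simp add: prod.list_conv_set_nth atLeast0LessThan length_ln_lower)
  also have "\<dots> = (\<Prod>i<20. ln_prime_lower i)"
    by (intro prod.cong) (auto simp: ln_prime_lower_def)
  finally show ?case by simp
next
  case (step k)
  define u v where "u = ln (real k) - 0.2" and "v = ln (real k + 1) - 0.2"
  have k: "real k \<ge> 20" using step.hyps by simp
  have u: "2.79 \<le> u" using ln_ge_if_ge_20[OF step.hyps(1)] by (simp add: u_def)
  have "v - u = ln (1 + 1 / real k)"
    using k ln_div[of "real k + 1" "real k"] by (simp add: u_def v_def add_divide_distrib)
  also have "\<dots> \<le> 1 / real k" using k by (intro ln_add_one_self_le_self) auto
  finally have vu: "v \<le> u + 1 / real k" by simp
  have v: "0 < v"
  proof -
    have "ln (real k) \<le> ln (real k + 1)" using k by simp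
    then show ?thesis using u by (simp add: u_def v_def)
  qed
  have "v / u \<le> 1 + 1 / (real k * u)" using vu u k by (simp add: field_simps)
  also have "\<dots> \<le> exp (1 / (real k * u))" by (rule exp_ge_add_one_self)
  finally have "(v / u) ^ k \<le> exp (1 / (real k * u)) ^ k"
    using u v by (intro power_mono) auto
  also have "\<dots> = exp (1 / u)" using k by (simp add: exp_of_nat_mult[symmetric])
  also have "\<dots> \<le> 1 + 1 / u + 0.7 * (1 / u)\<^sup>2"
    using u by (intro exp_le_quadratic) (auto simp: divide_le_eq)
  finally have "v * (v / u) ^ k \<le> v * (1 + 1 / u + 0.7 * (1 / u)\<^sup>2)"
    using v by simp
  also have "\<dots> = v + v * (1 / u + 0.7 * (1 / u)\<^sup>2)" by (simp add: algebra_simps)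
  also have "v * (1 / u + 0.7 * (1 / u)\<^sup>2) \<le> (u + 0.05) * (1 / u + 0.7 * (1 / u)\<^sup>2)"
  proof (rule mult_right_mono)
    have "1 / real k \<le> 1 / 20" using k by (intro divide_left_mono) auto
    then show "v \<le> u + 0.05" using vu by simp
  qed (use u in auto)
  also have "\<dots> = 1 + 0.75 * (1 / u) + 0.035 * (1 / u)\<^sup>2"
    using u by (simp add: field_simps power2_eq_square)
  \<comment> \<open>The expression decreases in \<open>u\<close>; at 2.79 it is about 1.273, while
    \<open>0.2 + ln 3\<close> is about 1.298.\<close>
  also have "\<dots> \<le> 1 + 0.75 * (1 / 2.79) + 0.035 * (1 / 2.79)\<^sup>2"
    using u by (intro add_mono mult_left_mono power_mono divide_left_mono) auto
  also have "\<dots> \<le> 0.2 + ln 3" using ln3 by (simp add: power2_eq_square)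
  also have "v + (0.2 + ln 3) = ln_prime_lower k"
  proof -
    have "ln (3 * real (Suc k)) = ln 3 + ln (real k + 1)"
      by (subst ln_mult) (auto simp: add.commute)
    then show ?thesis using step.hyps by (simp add: ln_prime_lower_def v_def)
  qed
  finally have *: "v * (v / u) ^ k \<le> ln_prime_lower k" by simp
  have "v ^ Suc k = u ^ k * (v * (v / u) ^ k)" using u by (simp add: power_divide)
  also have "\<dots> \<le> (\<Prod>i<k. ln_prime_lower i) * ln_prime_lower k"
    using * step.IH u v ln_prime_lower(1)
    by (intro mult_mono) (auto simp: u_def intro: prod_nonneg less_imp_le)
  finally show ?case by (simp add: v_def add.commute)
qed

text \<open>With \<open>A\<close> the sum \<open>X\<close> of the weights, the condition at
  \<open>A\<close> becomes \<open>X * (2 * l - e * (l - 0.2)) \<le> k * l * (l - 0.2)\<close>. The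
  bound \<open>X \<le> k * (l + 0.13)\<close> reduces it to a quadratic inequality in
  \<open>l = ln k\<close>.\<close>

lemma tau_le_large_omega:
  assumes n: "n \<ge> 2" and k: "omega n = k" "k \<ge> 20" and c: "c * (real k * ln (real k)) = e" "1.1999953 \<le> e"
  shows "real (tau n) \<le> (1 + c * ln (real n)) ^ k"
proof -
  define l X where "l = ln (real k)" and "X = (\<Sum>i<k. ln_prime_lower i)"
  have l: "2.9957 \<le> l" using ln_ge_if_ge_20[OF k(2)] by (simp add: l_def)
  have k0: "real k > 0" using k by simp
  have "real k * l \<noteq> 0" using k0 l by auto
  then have ce: "c = e / (real k * l)" using c(1) by (simp add: l_def eq_divide_eq)
  have X: "X \<le> ln (real n)" "X \<le> real k * (l + 0.13)" "0 \<le> X"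
    using sum_le_ln[OF n k(1), of ln_prime_lower] k ln_prime_lower sum_ln_prime_lower_le[OF k(2)]
    by (auto simp: X_def l_def intro!: sum_nonneg less_imp_le[OF ln_prime_lower(1)])
  show ?thesis
  proof (rule tau_le_if_relaxed_le[OF n k(1), where w = ln_prime_lower and g = "l - 0.2" and A = X])
    show "(l - 0.2) ^ k \<le> (\<Prod>i<k. ln_prime_lower i)"
      unfolding l_def by (rule prod_ln_prime_lower_ge[OF k(2)])
    have "l \<le> 1.1999953 * (l - 0.2)" using l by simp
    also have e: "\<dots> \<le> e * (l - 0.2)" using c(2) l by (intro mult_right_mono) auto
    finally show "1 / (real k * (l - 0.2)) \<le> c"
      using k0 l by (simp add: ce divide_simps mult.commute)
    have pos: "0 < l * (l - 0.2)" using l by simp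
    have "X * (2 * l - e * (l - 0.2)) \<le> X * (2 * l - 1.1999953 * (l - 0.2))"
      by (intro mult_left_mono diff_left_mono e X)
    also have "\<dots> \<le> real k * (l + 0.13) * (2 * l - 1.1999953 * (l - 0.2))"
      using X l by (intro mult_right_mono) auto
    also have "\<dots> = real k * ((l + 0.13) * (2 * l - 1.1999953 * (l - 0.2)))" by simp
    also have "\<dots> \<le> real k * (l * (l - 0.2))"
    proof (rule mult_left_mono)
      \<comment> \<open>The difference of the two sides, split at 2.9957, the lower bound for
        \<open>ln 20\<close>, into two visibly nonnegative parts.\<close>
      have "0 \<le> 0.1999953 * (l * (l - 2.9957)) + (0.05512624921 * l - 0.0311998778)"
        using l by (intro add_nonneg_nonneg mult_nonneg_nonneg) auto
      also have "\<dots> = l * (l - 0.2) - (l + 0.13) * (2 * l - 1.1999953 * (l - 0.2))"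
        by (simp add: field_simps)
      finally show "(l + 0.13) * (2 * l - 1.1999953 * (l - 0.2)) \<le> l * (l - 0.2)"
        by (simp only: diff_ge_0_iff_ge)
    qed simp
    finally have "X * (2 * l - e * (l - 0.2)) / (real k * (l * (l - 0.2))) \<le> 1"
      using pos k0 by (subst divide_le_eq_1_pos) auto
    moreover have "X * (2 * l - e * (l - 0.2)) / (real k * (l * (l - 0.2)))
        = (X + X) / (real k * (l - 0.2)) - c * X"
      using k0 l unfolding ce by (simp add: divide_simps) (simp add: algebra_simps)
    ultimately show "(X + (\<Sum>i<k. ln_prime_lower i)) / (real k * (l - 0.2)) \<le> 1 + c * X"
      by (simp add: X_def)
  qed (use l k X ln_prime_lower in auto)
qed

subsection \<open>The theorem\<close>

text \<open>Passes from the numerical factor of a single case to \<open>eta3\<close>, as the bound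
  increases with the factor.\<close>

lemma tau_le_if_coeff_le_eta3:
  assumes "n \<ge> 2" "omega n = k"
    and "real (tau n) \<le> (1 + c * ln (real n)) ^ k" "0 \<le> c" "c * (real k * log_plus (real k)) \<le> eta3"
    and "1 \<le> k"
  shows "real (tau n) \<le> (1 + eta3 * (ln (real n) / (real k * log_plus (real k)))) ^ k"
proof -
  have "0 < log_plus (real k)" by (simp add: log_plus_def)
  then have "c \<le> eta3 / (real k * log_plus (real k))"
    using assms by (simp add: pos_le_divide_eq)
  then have "c * ln (real n) \<le> eta3 / (real k * log_plus (real k)) * ln (real n)"
    using assms(1) by (intro mult_right_mono) auto
  then have "(1 + c * ln (real n)) ^ k \<le> (1 + eta3 * (ln (real n) / (real k * log_plus (real k)))) ^ k"
    using assms by (intro power_mono) auto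
  with assms(3) show ?thesis by linarith
qed

theorem theorem3:
  shows "(\<forall>n::nat. n \<ge> 2 \<longrightarrow>
           real (tau n) \<le>
             (1 + eta3 * (ln (real n) / (real (omega n) * log_plus (real (omega n))))) ^ omega n)
         \<and> eta3 = ((1152::real) powr (1 / 7) - 1) * 7 * ln 7 / ln 367567200
         \<and> 1.1999953 \<le> eta3 \<and> eta3 < 1.1999954"
proof (intro conjI allI impI eta3_eq eta3_bounds)
  fix n :: nat assume n: "n \<ge> 2"
  define k where "k = omega n"
  have k: "omega n = k" by (simp add: k_def)
  \<comment> \<open>For \<open>k = 19\<close> the factor is compared with \<open>eta3\<close>
    through an upper bound for \<open>ln 19\<close>, obtained from \<open>ln 20\<close>.\<close>
  have ln19: "ln (19::real) \<le> 2.94446"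
    using ln_add_one_ge[of 19] ln2 ln5 by (simp add: ln_composites)
  note bounds = eta3_bounds(1) ln_prime_bounds ln19
  have "k \<noteq> 0"
  proof
    assume "k = 0"
    then have "prime_factors n = {}" using k by (simp add: omega_def)
    then show False using n by (simp add: prime_factorization_empty_iff)
  qed
  moreover have "k \<in> {..<20} \<or> 20 \<le> k" by auto
  ultimately consider "k = 1" | "k = 2" | "k = 3" | "k = 4" | "k = 5" | "k = 6" | "k = 7" | "k = 8" | "k = 9" | "k = 10" | "k = 11" | "k = 12" | "k = 13" | "k = 14" | "k = 15" | "k = 16" | "k = 17" | "k = 18" | "k = 19" | "20 \<le> k"
    by (auto simp: lessThan_nat_numeral lessThan_Suc)
  then have "real (tau n) \<le> (1 + eta3 * (ln (real n) / (real k * log_plus (real k)))) ^ k"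
  proof cases
    case 1
    then show ?thesis
      using tau_le_if_coeff_le_eta3[OF n _ tau_le_omega_1[OF n]] k bounds
      by (simp add: log_plus_def ln_composites)
  next
    case 2
    then show ?thesis
      using tau_le_if_coeff_le_eta3[OF n _ tau_le_omega_2[OF n]] k bounds
      by (simp add: log_plus_def ln_composites)
  next
    case 3
    then show ?thesis
      using tau_le_if_coeff_le_eta3[OF n _ tau_le_omega_3[OF n]] k bounds
      by (simp add: log_plus_def ln_composites)
  next
    case 4
    then show ?thesis
      using tau_le_if_coeff_le_eta3[OF n _ tau_le_omega_4[OF n]] k bounds
      by (simp add: log_plus_def ln_composites)
  next
    case 5
    then show ?thesis
      using tau_le_if_coeff_le_eta3[OF n _ tau_le_omega_5[OF n]] k bounds
      by (simp add: log_plus_def ln_composites)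
  next
    case 6
    then show ?thesis
      using tau_le_if_coeff_le_eta3[OF n _ tau_le_omega_6[OF n]] k bounds
      by (simp add: log_plus_def ln_composites)
  next
    case 7
    \<comment> \<open>The exact factor, since equality occurs at 367567200.\<close>
    define c where "c = eta3 / (7 * ln 7)"
    have "0.0880965 \<le> c"
      using bounds by (simp add: c_def pos_le_divide_eq)
    moreover have "1 + c * ln 367567200 = (1152::real) powr (1 / 7)"
      by (simp add: c_def eta3_eq field_simps)
    then have "7 * ln (1 + c * ln 367567200) = ln (1152::real)"
      by (simp add: ln_powr)
    ultimately show ?thesis
      using tau_le_if_coeff_le_eta3[OF n, of 7 c] tau_le_omega_7[OF n, of c] k 7
      by (simp add: c_def log_plus_def)
  next
    case 8
    then show ?thesis
      using tau_le_if_coeff_le_eta3[OF n _ tau_le_omega_8[OF n]] k bounds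
      by (simp add: log_plus_def ln_composites)
  next
    case 9
    then show ?thesis
      using tau_le_if_coeff_le_eta3[OF n _ tau_le_omega_9[OF n]] k bounds
      by (simp add: log_plus_def ln_composites)
  next
    case 10
    then show ?thesis
      using tau_le_if_coeff_le_eta3[OF n _ tau_le_omega_10[OF n]] k bounds
      by (simp add: log_plus_def ln_composites)
  next
    case 11
    then show ?thesis
      using tau_le_if_coeff_le_eta3[OF n _ tau_le_omega_11[OF n]] k bounds
      by (simp add: log_plus_def ln_composites)
  next
    case 12
    then show ?thesis
      using tau_le_if_coeff_le_eta3[OF n _ tau_le_omega_12[OF n]] k bounds
      by (simp add: log_plus_def ln_composites)
  next
    case 13
    then show ?thesis
      using tau_le_if_coeff_le_eta3[OF n _ tau_le_omega_13[OF n]] k bounds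
      by (simp add: log_plus_def ln_composites)
  next
    case 14
    then show ?thesis
      using tau_le_if_coeff_le_eta3[OF n _ tau_le_omega_14[OF n]] k bounds
      by (simp add: log_plus_def ln_composites)
  next
    case 15
    then show ?thesis
      using tau_le_if_coeff_le_eta3[OF n _ tau_le_omega_15[OF n]] k bounds
      by (simp add: log_plus_def ln_composites)
  next
    case 16
    then show ?thesis
      using tau_le_if_coeff_le_eta3[OF n _ tau_le_omega_16[OF n]] k bounds
      by (simp add: log_plus_def ln_composites)
  next
    case 17
    then show ?thesis
      using tau_le_if_coeff_le_eta3[OF n _ tau_le_omega_17[OF n]] k bounds
      by (simp add: log_plus_def ln_composites)
  next
    case 18
    then show ?thesis
      using tau_le_if_coeff_le_eta3[OF n _ tau_le_omega_18[OF n]] k bounds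
      by (simp add: log_plus_def ln_composites)
  next
    case 19
    then show ?thesis
      using tau_le_if_coeff_le_eta3[OF n _ tau_le_omega_19[OF n]] k bounds
      by (simp add: log_plus_def ln_composites)
  next
    case 20
    then have "0 < real k * ln (real k)" by simp
    then show ?thesis
      using eta3_bounds(1) 20
      by (intro tau_le_if_coeff_le_eta3[OF n k tau_le_large_omega[OF n k 20,
            of "eta3 / (real k * ln (real k))" eta3]]) (auto simp: log_plus_def)
  qed
  then show "real (tau n) \<le>
      (1 + eta3 * (ln (real n) / (real (omega n) * log_plus (real (omega n))))) ^ omega n"
    by (simp only: k_def)
qed

end
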